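(* For every integer $d\ge 3$ and every $\varepsilon>0$ there exists a gadget of order $(d,d-1)$ in dimension $d$ whose distinguished (unit) vectors $|m_1\rangle,\dots,|m_d\rangle\in\mathbb C^d$ satisfy $\langle m_i|m_j\rangle>1-\varepsilon$ for all $i\ne j$ (the overlaps being real).
   Context: All vector sets are finite sets of pairwise non-parallel unit vectors in $\mathbb C^d$. The orthogonality graph of such a set has the vectors as vertices, two vertices being adjacent iff the vectors are orthogonal. For a finite simple graph $G$ with clique number $\omega(G)$, a $\{0,1\}$-coloring of $G$ is a map $f:V_G\to\{0,1\}$ such that (i) $\sum_{v\in C}f(v)\le 1$ for every clique $C$ of $G$, and (ii) every clique $C$ of size $\omega(G)$ contains exactly one vertex $v$ with $f(v)=1$. A $\{0,1\}$-coloring of a set of vectors is a $\{0,1\}$-coloring of its orthogonality graph. A gadget of order $(m,k)$ in dimension $d$ is a set of vectors $\mathcal S\subset\mathbb C^d$ whose orthogonality graph has clique number $d$, which admits a $\{0,1\}$-coloring, and which contains a distinguished proper subset $\widetilde{\mathcal S}\subsetneq\mathcal S$ of $m$ mutually non-orthogonal vectors such that: for every $\mathcal R\subseteq\widetilde{\mathcal S}$ with $|\mathcal R|\le k$ there is a $\{0,1\}$-coloring of $\mathcal S$ assigning $1$ to all vectors of $\mathcal R$; and for every $\mathcal R\subseteq\widetilde{\mathcal S}$ with $|\mathcal R|>k$ no $\{0,1\}$-coloring of $\mathcal S$ assigns $1$ to all vectors of $\mathcal R$. *)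

theory Defs
  imports "Jordan_Normal_Form.Matrix" "HOL-Library.FuncSet"
begin

text \<open>A finite simple graph is given by its vertex set \<open>V\<close> and an adjacency relation \<open>adj\<close>, of which
  only the values at pairs of distinct vertices of \<open>V\<close> are relevant.\<close>

definition is_clique :: "'a set \<Rightarrow> ('a \<Rightarrow> 'a \<Rightarrow> bool) \<Rightarrow> 'a set \<Rightarrow> bool" where
  "is_clique V adj C \<longleftrightarrow> C \<subseteq> V \<and> (\<forall>u\<in>C. \<forall>v\<in>C. u \<noteq> v \<longrightarrow> adj u v)"

definition clique_number :: "'a set \<Rightarrow> ('a \<Rightarrow> 'a \<Rightarrow> bool) \<Rightarrow> nat" where
  "clique_number V adj = Max (card ` {C. is_clique V adj C})"

definition zero_one_coloring :: "'a set \<Rightarrow> ('a \<Rightarrow> 'a \<Rightarrow> bool) \<Rightarrow> ('a \<Rightarrow> nat) \<Rightarrow> bool" where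
  "zero_one_coloring V adj f \<longleftrightarrow>
     f \<in> V \<rightarrow> {0, 1} \<and>
     (\<forall>C. is_clique V adj C \<longrightarrow> (\<Sum>v\<in>C. f v) \<le> 1) \<and>
     (\<forall>C. is_clique V adj C \<and> card C = clique_number V adj \<longrightarrow> (\<exists>!v. v \<in> C \<and> f v = 1))"

text \<open>The second factor of \<open>\<bullet>c\<close> is the conjugated one, so \<open>braket u v\<close> is conjugate-linear in \<open>u\<close>.\<close>

definition braket :: "complex vec \<Rightarrow> complex vec \<Rightarrow> complex" where
  "braket u v = v \<bullet>c u"

definition orthogonal_vecs :: "complex vec \<Rightarrow> complex vec \<Rightarrow> bool" where
  "orthogonal_vecs u v \<longleftrightarrow> braket u v = 0"

definition vector_set :: "nat \<Rightarrow> complex vec set \<Rightarrow> bool" where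
  "vector_set d S \<longleftrightarrow>
     finite S \<and> S \<subseteq> carrier_vec d \<and>
     (\<forall>v\<in>S. braket v v = 1) \<and>
     (\<forall>u\<in>S. \<forall>v\<in>S. u \<noteq> v \<longrightarrow> \<not> (\<exists>c. u = c \<cdot>\<^sub>v v))"

abbreviation vector_coloring :: "complex vec set \<Rightarrow> (complex vec \<Rightarrow> nat) \<Rightarrow> bool" where
  "vector_coloring S \<equiv> zero_one_coloring S orthogonal_vecs"

definition gadget :: "nat \<Rightarrow> nat \<Rightarrow> nat \<Rightarrow> complex vec set \<Rightarrow> complex vec set \<Rightarrow> bool" where
  "gadget m k d S T \<longleftrightarrow>
     vector_set d S \<and>
     clique_number S orthogonal_vecs = d \<and>
     (\<exists>f. vector_coloring S f) \<and>
     T \<subset> S \<and> card T = m \<and>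
     (\<forall>u\<in>T. \<forall>v\<in>T. u \<noteq> v \<longrightarrow> \<not> orthogonal_vecs u v) \<and>
     (\<forall>R \<subseteq> T. card R \<le> k \<longrightarrow> (\<exists>f. vector_coloring S f \<and> (\<forall>v\<in>R. f v = 1))) \<and>
     (\<forall>R \<subseteq> T. card R > k \<longrightarrow> \<not> (\<exists>f. vector_coloring S f \<and> (\<forall>v\<in>R. f v = 1)))"

end

theory Submission
  imports Defs "Jordan_Normal_Form.Determinant"
begin

text \<open>Since exactly one vector of the standard basis \<open>e\<^sub>1, \<dots>, e\<^sub>d\<close> has value 1, the vectors
  \<open>m\<^sub>1, \<dots>, m\<^sub>d\<close> cannot all have value 1 as soon as every pair \<open>m\<^sub>i, e\<^sub>i\<close> is excluded from having
  value 1 simultaneously; if only these pairs are excluded, any \<open>d - 1\<close> of the \<open>m\<^sub>i\<close> remain compatible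
  with the remaining \<open>e\<^sub>j\<close>. Taking \<open>m\<^sub>i\<close> close to \<open>(1, \<dots>, 1) / \<surd>d\<close> makes the overlaps close to 1, and
  leaves overlaps of at most \<open>1 / \<surd>3\<close> between \<open>m\<^sub>i\<close> and \<open>e\<^sub>i\<close>. A pair of overlap less than \<open>1 / 3\<close> is
  excluded by Clifton's gadget, and two such exclusions, combined through one auxiliary basis, reach
  overlap \<open>3 / 5\<close>. The exclusions are added one after the other in general position with respect to
  all vectors already present, so that no unintended orthogonality arises and every coloring that
  respects the new exclusion extends.\<close>

section \<open>The overlap and orthonormal families\<close>

text \<open>The obstacle is a vector lying in the plane of two others: it is automatically
  orthogonal to every vector that completes these two to an orthonormal basis, however that basis is
  chosen. General position is therefore expressed by a finite set \<open>F\<close> whose members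
  must have nonzero overlap with every new vector and must, as a rule, lie outside the plane in
  question. That a set misses a plane is certified by one vector orthogonal to the plane but to no
  member of the set. Certificates of planes still to be treated are themselves put into
  \<open>F\<close>, so that the vectors added meanwhile stay outside those planes. Origin of the
  constants: the equation behind Clifton's gadget has a real solution only up to overlap 1/3. Two
  exclusions within one plane add up their angles and would reach cos(arccos(1/3) - arcsin(1/3)) = 4
  sqrt(2) / 9, about 0.628. This exceeds 1 / sqrt(3), about 0.577, the worst overlap that has to be
  excluded; 3/5 is a rational number in between that leaves room for a small tilt out of the
  plane.\<close>

lemma braket_sum:
  assumes "u \<in> carrier_vec d" "v \<in> carrier_vec d"
  shows "braket u v = (\<Sum>i<d. cnj (u $ i) * v $ i)"
  using assms by (auto simp: braket_def scalar_prod_def atLeast0LessThan mult.commute intro!: sum.cong)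

lemma braket_cnj:
  assumes "u \<in> carrier_vec d" "v \<in> carrier_vec d"
  shows "braket v u = cnj (braket u v)"
  using assms by (simp add: braket_sum[where d = d] mult.commute)

lemma braket_add_right:
  assumes "u \<in> carrier_vec d" "v \<in> carrier_vec d" "w \<in> carrier_vec d"
  shows "braket u (v + w) = braket u v + braket u w"
  using assms by (simp add: braket_sum[where d = d] distrib_left sum.distrib)

lemma braket_smult_right:
  assumes "u \<in> carrier_vec d" "v \<in> carrier_vec d"
  shows "braket u (a \<cdot>\<^sub>v v) = a * braket u v"
  using assms by (simp add: braket_sum[where d = d] sum_distrib_left mult_ac)

lemma braket_add_left:
  assumes "u \<in> carrier_vec d" "v \<in> carrier_vec d" "w \<in> carrier_vec d"
  shows "braket (v + w) u = braket v u + braket w u"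
  using assms by (simp add: braket_sum[where d = d] distrib_right sum.distrib)

lemma braket_smult_left:
  assumes "u \<in> carrier_vec d" "v \<in> carrier_vec d"
  shows "braket (a \<cdot>\<^sub>v v) u = cnj a * braket v u"
  using assms by (simp add: braket_sum[where d = d] sum_distrib_left mult_ac)

lemmas braket_simps = braket_add_right braket_smult_right braket_add_left braket_smult_left

lemma braket_self:
  assumes "v \<in> carrier_vec d"
  shows "braket v v = complex_of_real (\<Sum>i<d. (cmod (v $ i))\<^sup>2)"
  using assms by (simp add: braket_sum[where d = d] complex_norm_square mult.commute del: of_real_power)

lemma braket_self_eq_0:
  assumes "v \<in> carrier_vec d" "braket v v = 0"
  shows "v = 0\<^sub>v d"
proof -
  have "(\<Sum>i<d. (cmod (v $ i))\<^sup>2) = 0"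
    using assms by (simp add: braket_self del: of_real_sum)
  then have "\<forall>i<d. v $ i = 0"
    by (subst (asm) sum_nonneg_eq_0_iff) auto
  then show ?thesis using assms by auto
qed

lemma orthogonal_commute:
  assumes "u \<in> carrier_vec d" "v \<in> carrier_vec d"
  shows "orthogonal_vecs u v \<longleftrightarrow> orthogonal_vecs v u"
  using braket_cnj[OF assms] by (simp add: orthogonal_vecs_def)

definition on_seq :: "nat \<Rightarrow> nat \<Rightarrow> (nat \<Rightarrow> complex vec) \<Rightarrow> bool" where
  "on_seq d k B \<longleftrightarrow> (\<forall>i<k. B i \<in> carrier_vec d) \<and>
     (\<forall>i<k. \<forall>j<k. braket (B i) (B j) = (if i = j then 1 else 0))"

text \<open>\<open>M * N\<close> is the Gram matrix of the family, hence the identity. For square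
  matrices \<open>N * M\<close> is then the identity as well, and
  \<open>z = N (M z) = 0\<close>.\<close>

lemma on_seq_orth_zero:
  assumes B: "on_seq d d B" and z: "z \<in> carrier_vec d" and orth: "\<And>i. i < d \<Longrightarrow> braket (B i) z = 0"
  shows "z = 0\<^sub>v d"
proof -
  define M where "M = mat d d (\<lambda>(i,j). cnj (B i $ j))"
  define N where "N = mat d d (\<lambda>(i,j). B j $ i)"
  have M: "M \<in> carrier_mat d d" and N: "N \<in> carrier_mat d d" by (auto simp: M_def N_def)
  have Bc: "B i \<in> carrier_vec d" if "i < d" for i using B that by (auto simp: on_seq_def)
  have "M * N = 1\<^sub>m d"
  proof (rule eq_matI)
    fix i j assume ij: "i < dim_row (1\<^sub>m d :: complex mat)" "j < dim_col (1\<^sub>m d :: complex mat)"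
    then have "(M * N) $$ (i,j) = braket (B i) (B j)"
      using Bc by (auto simp: M_def N_def scalar_prod_def braket_sum[OF Bc Bc] atLeast0LessThan)
    then show "(M * N) $$ (i,j) = 1\<^sub>m d $$ (i,j)"
      using ij B by (auto simp: on_seq_def)
  qed (auto simp: M_def N_def)
  then have NM: "N * M = 1\<^sub>m d"
    using mat_mult_left_right_inverse M N by blast
  have "M *\<^sub>v z = 0\<^sub>v d"
  proof (rule eq_vecI)
    fix i assume "i < dim_vec (0\<^sub>v d :: complex vec)"
    then have i: "i < d" by simp
    then have "(M *\<^sub>v z) $ i = braket (B i) z"
      using Bc z by (auto simp: M_def scalar_prod_def braket_sum[OF Bc z] atLeast0LessThan)
    then show "(M *\<^sub>v z) $ i = 0\<^sub>v d $ i" using orth i by simp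
  qed (auto simp: M_def)
  then have "(N * M) *\<^sub>v z = 0\<^sub>v d"
    using M N z by (simp add: assoc_mult_mat_vec[OF N M z]) 
       (auto intro!: eq_vecI simp: N_def scalar_prod_def)
  then show ?thesis using NM z by simp
qed

definition normalized :: "complex vec \<Rightarrow> complex vec" where
  "normalized v = (1 / complex_of_real (sqrt (Re (braket v v)))) \<cdot>\<^sub>v v"

lemma braket_self_pos:
  assumes "v \<in> carrier_vec d" "v \<noteq> 0\<^sub>v d"
  shows "Re (braket v v) > 0" "braket v v = complex_of_real (Re (braket v v))"
proof -
  show *: "braket v v = complex_of_real (Re (braket v v))"
    using assms by (simp add: braket_self del: of_real_sum)
  have "Re (braket v v) \<ge> 0"
    using assms by (simp add: braket_self sum_nonneg del: of_real_sum)
  moreover have "Re (braket v v) \<noteq> 0"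
    using braket_self_eq_0[OF assms(1)] * assms(2) by auto
  ultimately show "Re (braket v v) > 0" by simp
qed

lemma normalized_unit:
  assumes "v \<in> carrier_vec d" "v \<noteq> 0\<^sub>v d"
  shows "normalized v \<in> carrier_vec d" "braket (normalized v) (normalized v) = 1"
proof -
  show "normalized v \<in> carrier_vec d" using assms by (simp add: normalized_def)
  define r where "r = Re (braket v v)"
  have r: "r > 0" "braket v v = complex_of_real r"
    using braket_self_pos[OF assms] by (auto simp: r_def)
  have "complex_of_real (sqrt r) * complex_of_real (sqrt r) = complex_of_real r"
    using r(1) by (simp flip: of_real_mult)
  then show "braket (normalized v) (normalized v) = 1"
    using assms r(1) unfolding normalized_def r_def[symmetric]
    by (simp add: braket_simps[where d = d] r(2) divide_simps)
qed

lemma normalized_orth_iff: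
  assumes "v \<in> carrier_vec d" "v \<noteq> 0\<^sub>v d" "u \<in> carrier_vec d"
  shows "braket u (normalized v) = 0 \<longleftrightarrow> braket u v = 0" "braket (normalized v) u = 0 \<longleftrightarrow> braket v u = 0"
  using braket_self_pos[OF assms(1,2)] assms
  by (auto simp: normalized_def braket_simps[where d = d])

lemma on_seq_extend_one:
  assumes B: "on_seq d k B" and k: "k < d"
  shows "\<exists>v. on_seq d (Suc k) (B(k := v))"
proof -
  have Bc: "B i \<in> carrier_vec d" if "i < k" for i using B that by (auto simp: on_seq_def)
  \<comment> \<open>Rows from \<open>k\<close> on are padded with zeros. Row \<open>k\<close> makes
    this square matrix singular, and a kernel vector is orthogonal to every
    \<open>B i\<close>.\<close>
  define M where "M = mat d d (\<lambda>(i,j). if i < k then cnj (B i $ j) else 0)"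
  have M: "M \<in> carrier_mat d d" by (auto simp: M_def)
  have "M\<^sup>T *\<^sub>v unit_vec d k = 0\<^sub>v d"
    using k by (auto simp: M_def intro!: eq_vecI)
  moreover have "unit_vec d k \<noteq> (0\<^sub>v d :: complex vec)"
    using k by (metis index_unit_vec(2) index_zero_vec(1) zero_neq_one)
  ultimately have "det M\<^sup>T = 0"
    using det_0_iff_vec_prod_zero_field[of "M\<^sup>T" d] M unit_vec_carrier[of d k]
    by (metis transpose_carrier_mat)
  then have "det M = 0" using det_transpose[OF M] by simp
  then obtain v where v: "v \<in> carrier_vec d" "v \<noteq> 0\<^sub>v d" "M *\<^sub>v v = 0\<^sub>v d"
    using det_0_iff_vec_prod_zero_field[OF M] by auto
  have orth: "braket (B i) v = 0" if "i < k" for i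
  proof -
    have "(M *\<^sub>v v) $ i = braket (B i) v"
      using Bc that k v(1) by (auto simp: M_def scalar_prod_def braket_sum[OF Bc v(1)] atLeast0LessThan)
    then show ?thesis using v that k by simp
  qed
  have orth': "braket v (B i) = 0" if "i < k" for i
    using orth[OF that] braket_cnj[OF Bc[OF that] v(1)] by simp
  have "on_seq d (Suc k) (B(k := normalized v))"
    using B normalized_unit[OF v(1,2)] orth orth' normalized_orth_iff[OF v(1,2) Bc]
    by (auto simp: on_seq_def less_Suc_eq)
  then show ?thesis by blast
qed

lemma on_seq_extend:
  assumes "on_seq d k B" "k \<le> d"
  shows "\<exists>B'. on_seq d d B' \<and> (\<forall>i<k. B' i = B i)"
  using assms(2,1)
proof (induction k arbitrary: B rule: inc_induct)
  case base then show ?case by auto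
next
  case (step n)
  obtain v where "on_seq d (Suc n) (B(n := v))"
    using on_seq_extend_one step by metis
  from step.IH[OF this] show ?case by (auto simp: less_Suc_eq)
qed

text \<open>In a larger set, the vector with index \<open>d\<close> would be orthogonal to
  \<open>d\<close> orthonormal vectors and hence zero. This is the upper bound on the size of
  cliques.\<close>

lemma card_orthonormal_le:
  assumes "finite C" "C \<subseteq> carrier_vec d" "\<And>x. x \<in> C \<Longrightarrow> braket x x = 1"
    "\<And>x y. x \<in> C \<Longrightarrow> y \<in> C \<Longrightarrow> x \<noteq> y \<Longrightarrow> braket x y = 0"
  shows "card C \<le> d"
proof (rule ccontr)
  assume "\<not> ?thesis"
  then have lt: "d < card C" by simp
  obtain B where B: "bij_betw B {0..<card C} C"
    using ex_bij_betw_nat_finite[OF assms(1)] by blast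
  have mem: "B i \<in> C" if "i < card C" for i using B that by (auto simp: bij_betw_def)
  have inj: "B i \<noteq> B j" if "i < card C" "j < card C" "i \<noteq> j" for i j
    using B that by (auto simp: bij_betw_def inj_on_def)
  have "on_seq d d B"
    unfolding on_seq_def using mem inj lt assms(2-4) by (auto dest!: less_trans[OF _ lt])
  moreover have "braket (B i) (B d) = 0" if "i < d" for i
    using that lt mem inj assms(4) by (metis less_trans nat_neq_iff)
  ultimately have "B d = 0\<^sub>v d"
    using on_seq_orth_zero mem[OF lt] assms(2) by blast
  then have "braket (B d) (B d) = 0" by (simp add: braket_def)
  with assms(3) mem[OF lt] show False by simp
qed

section \<open>Bases in general position\<close>

definition span2 :: "complex vec \<Rightarrow> complex vec \<Rightarrow> complex vec set" where
  "span2 p q = {a \<cdot>\<^sub>v p + b \<cdot>\<^sub>v q | a b. True}"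

lemma span2_orth:
  assumes "p \<in> carrier_vec d" "q \<in> carrier_vec d" "r \<in> carrier_vec d"
    and "braket r p = 0" "braket r q = 0" "x \<in> span2 p q"
  shows "braket r x = 0"
  using assms by (auto simp: span2_def braket_simps[where d = d])

lemma infinite_circle: "infinite {z :: complex. cmod z = 1}"
proof
  assume "finite {z :: complex. cmod z = 1}"
  then have "finite (Re ` {z. cmod z = 1})" by simp
  moreover have "{0..1} \<subseteq> Re ` {z. cmod z = 1}"
  proof
    fix x :: real assume "x \<in> {0..1}"
    then have "x\<^sup>2 \<le> 1" by (simp add: power_le_one)
    then have "cmod (Complex x (sqrt (1 - x\<^sup>2))) = 1" by (simp add: cmod_def)
    then show "x \<in> Re ` {z. cmod z = 1}" by (metis (mono_tags) complex.sel(1) image_eqI mem_Collect_eq)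
  qed
  ultimately have "finite {0..1::real}" by (rule rev_finite_subset)
  moreover have "infinite {0..1::real}" by (rule infinite_Icc) simp
  ultimately show False by simp
qed

text \<open>All genericity is obtained here: one phase \<open>t\<close>, finitely many conditions,
  each of which fails for finitely many \<open>t\<close> only.\<close>

lemma avoid_on_circle:
  assumes "finite I" "\<And>i. i \<in> I \<Longrightarrow> finite (bad i)"
  obtains t :: complex where "cmod t = 1" "\<And>i. i \<in> I \<Longrightarrow> t \<notin> bad i"
proof -
  have "finite (\<Union>i\<in>I. bad i)" using assms by auto
  then have "\<not> {z. cmod z = 1} \<subseteq> (\<Union>i\<in>I. bad i)" using infinite_circle finite_subset by blast
  then show ?thesis using that by blast
qed

text \<open>The terms are powers of \<open>z\<close>, an \<open>m\<close>-th root of unity that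
  differs from 1 when the indices differ, so the geometric sum vanishes.\<close>

lemma roots_of_unity_orthogonal:
  fixes m k k' :: nat
  defines "\<omega> \<equiv> \<lambda>k. cis (2 * pi * real k / real m)"
  assumes "k < m" "k' < m"
  shows "(\<Sum>l<m. cnj (\<omega> k ^ l) * \<omega> k' ^ l) = (if k = k' then of_nat m else 0)"
proof -
  have m: "m > 0" using assms by simp
  have w1: "\<omega> k * cnj (\<omega> k) = 1" by (simp add: \<omega>_def cis_mult cis_cnj)
  define z where "z = cnj (\<omega> k) * \<omega> k'"
  have sum: "(\<Sum>l<m. cnj (\<omega> k ^ l) * \<omega> k' ^ l) = (\<Sum>l<m. z ^ l)"
    by (simp add: z_def power_mult_distrib)
  have pow: "\<omega> j ^ m = 1" for j
  proof -
    have "\<omega> j ^ m = cis (real m * (2 * pi * real j / real m))" by (simp add: \<omega>_def DeMoivre)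
    also have "\<dots> = cis (2 * pi * real j)" using m by simp
    also have "\<dots> = 1" by (rule cis_multiple_2pi) simp
    finally show ?thesis .
  qed
  show ?thesis
  proof (cases "k = k'")
    case True
    then have "z = 1" using w1 by (simp add: z_def mult.commute)
    then show ?thesis using sum True by simp
  next
    case False
    have "inj_on \<omega> {..<m}"
      using bij_betw_roots_unity[OF m] by (auto simp: bij_betw_def \<omega>_def)
    then have "\<omega> k \<noteq> \<omega> k'" using False assms by (auto simp: inj_on_def)
    have "z \<noteq> 1"
    proof
      assume "z = 1"
      then have "\<omega> k * (cnj (\<omega> k) * \<omega> k') = \<omega> k" by (simp add: z_def)
      then show False using w1 \<open>\<omega> k \<noteq> \<omega> k'\<close> by (simp add: mult.assoc[symmetric])
    qed
    moreover have "z ^ m = 1" by (simp add: z_def power_mult_distrib pow flip: complex_cnj_power)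
    ultimately show ?thesis using sum False by (simp add: geometric_sum)
  qed
qed

text \<open>The rows \<open>\<omega>\<^sup>k\<^sup>l t\<^sup>l / \<surd>m\<close> of a twisted discrete Fourier matrix are orthonormal for \<open>\<bar>t\<bar> = 1\<close>, while
  the overlaps of the resulting vectors with a fixed vector are polynomials in \<open>t\<close>.\<close>

lemma generic_completion:
  assumes p: "p \<in> carrier_vec d" "braket p p = 1" and q: "q \<in> carrier_vec d" "braket q q = 1"
    and pq: "braket p q = 0" and d: "d \<ge> 3"
    and F: "finite F" "F \<subseteq> carrier_vec d" "F \<inter> span2 p q = {}"
  obtains n where "on_seq d (d - 2) n"
    "\<And>k. k < d - 2 \<Longrightarrow> braket p (n k) = 0 \<and> braket q (n k) = 0"
    "\<And>k z. k < d - 2 \<Longrightarrow> z \<in> F \<Longrightarrow> braket z (n k) \<noteq> 0"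
proof -
  define m where "m = d - 2"
  have m: "m > 0" "d = Suc (Suc m)" using d by (auto simp: m_def)
  have qp: "braket q p = 0" using braket_cnj[OF p(1) q(1)] pq by simp
  have "on_seq d 2 (\<lambda>i. if i = 0 then p else q)"
    using p q pq qp by (auto simp: on_seq_def)
  then obtain B where B: "on_seq d d B" and B01: "\<forall>i<2. B i = (if i = 0 then p else q)"
    using on_seq_extend[of d 2] d by fastforce
  have B0: "B 0 = p" and B1: "B (Suc 0) = q" using B01 by auto
  define e where "e l = B (Suc (Suc l))" for l
  have ec: "e l \<in> carrier_vec d" if "l < m" for l
    using B that m by (auto simp: on_seq_def e_def)
  have ee: "braket (e k) (e l) = (if k = l then 1 else 0)" if "k < m" "l < m" for k l
    using B that m by (auto simp: on_seq_def e_def)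
  have pe: "braket p (e l) = 0" "braket q (e l) = 0" if "l < m" for l
  proof -
    have "braket (B 0) (B (Suc (Suc l))) = 0" "braket (B (Suc 0)) (B (Suc (Suc l))) = 0"
      using B that m(2) by (auto simp: on_seq_def)
    then show "braket p (e l) = 0" "braket q (e l) = 0" using B0 B1 by (simp_all add: e_def)
  qed
  define \<omega> where "\<omega> = (\<lambda>k::nat. cis (2 * pi * real k / real m))"
  define c where "c t k l = \<omega> k ^ l * t ^ l / complex_of_real (sqrt (real m))" for t k l
  define n where "n t k = vec d (\<lambda>i. \<Sum>l<m. c t k l * e l $ i)" for t k
  have nc: "n t k \<in> carrier_vec d" for t k by (simp add: n_def)
  have ip: "braket z (n t k) = (\<Sum>l<m. c t k l * braket z (e l))" if z: "z \<in> carrier_vec d" for z t k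
  proof -
    have "braket z (n t k) = (\<Sum>i<d. \<Sum>l<m. c t k l * (cnj (z $ i) * e l $ i))"
      unfolding braket_sum[OF z nc] by (auto simp: n_def sum_distrib_left mult_ac intro!: sum.cong)
    also have "\<dots> = (\<Sum>l<m. \<Sum>i<d. c t k l * (cnj (z $ i) * e l $ i))" by (rule sum.swap)
    also have "\<dots> = (\<Sum>l<m. c t k l * braket z (e l))"
      using ec by (intro sum.cong) (auto simp: braket_sum[OF z ec] sum_distrib_left)
    finally show ?thesis .
  qed
  have ip_e: "braket (e l) (n t k) = c t k l" if "l < m" for l t k
  proof -
    have "braket (e l) (n t k) = (\<Sum>j<m. if j = l then c t k j else 0)"
      unfolding ip[OF ec[OF that]] using that by (intro sum.cong) (auto simp: ee)
    then show ?thesis using that by simp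
  qed
  \<comment> \<open>Up to the factor \<open>1 / sqrt m\<close> this polynomial is the overlap of
    \<open>z\<close> with \<open>n t k\<close>. It has finitely many roots unless all coefficients
    vanish; but then \<open>z\<close> is orthogonal to every \<open>e l\<close> and so lies in the
    excluded plane of \<open>p\<close> and \<open>q\<close>.\<close>
  define bad where "bad = (\<lambda>(z, k). {t. (\<Sum>l\<le>m - 1. \<omega> k ^ l * braket z (e l) * t ^ l) = 0})"
  have "finite (bad i)" if i: "i \<in> F \<times> {..<m}" for i
  proof -
    obtain z k where zk: "i = (z, k)" "z \<in> F" "k < m" using i by auto
    have z: "z \<in> carrier_vec d" using zk F by auto
    have "\<exists>l<m. braket (e l) z \<noteq> 0"
    proof (rule ccontr)
      assume no: "\<not> ?thesis"
      define z' where "z' = z + (- braket p z) \<cdot>\<^sub>v p + (- braket q z) \<cdot>\<^sub>v q"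
      have "z' = 0\<^sub>v d"
      proof (rule on_seq_orth_zero[OF B])
        show "z' \<in> carrier_vec d" using z p q by (simp add: z'_def)
        fix i assume "i < d"
        then consider "i = 0" | "i = Suc 0" | l where "l < m" "i = Suc (Suc l)"
          using m by (metis Suc_less_eq not0_implies_Suc)
        then show "braket (B i) z' = 0"
        proof cases
          case 1 then show ?thesis using B0 p q pq z(1) by (simp add: z'_def braket_simps[where d = d])
        next
          case 2 then show ?thesis using B1 p q qp z by (simp add: z'_def braket_simps[where d = d])
        next
          case 3
          then have "braket (e l) p = 0" "braket (e l) q = 0"
            using pe[OF 3(1)] braket_cnj[OF p(1) ec[OF 3(1)]] braket_cnj[OF q(1) ec[OF 3(1)]] by simp_all
          then show ?thesis using no 3 p q z ec[OF 3(1)]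
            by (simp add: z'_def braket_simps[where d = d] e_def[symmetric])
        qed
      qed
      have "z = braket p z \<cdot>\<^sub>v p + braket q z \<cdot>\<^sub>v q"
      proof (rule eq_vecI)
        fix i assume "i < dim_vec (braket p z \<cdot>\<^sub>v p + braket q z \<cdot>\<^sub>v q)"
        then have i: "i < d" using q by simp
        have "z' $ i = 0" using \<open>z' = 0\<^sub>v d\<close> i by simp
        then show "z $ i = (braket p z \<cdot>\<^sub>v p + braket q z \<cdot>\<^sub>v q) $ i"
          using i p q z by (simp add: z'_def algebra_simps)
      qed (use z q in auto)
      then have "z \<in> span2 p q" unfolding span2_def by blast
      then show False using F zk by auto
    qed
    then obtain l where l: "l < m" "braket (e l) z \<noteq> 0" by auto
    then have "braket z (e l) \<noteq> 0" using braket_cnj[OF z ec[OF l(1)]] by auto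
    moreover have "\<omega> k ^ l \<noteq> 0" by (simp add: \<omega>_def)
    ultimately have "\<exists>l\<le>m - 1. \<omega> k ^ l * braket z (e l) \<noteq> 0" using l by (intro exI[of _ l]) auto
    then show ?thesis using polyfun_finite_roots[of "\<lambda>l. \<omega> k ^ l * braket z (e l)" "m - 1"]
      by (simp add: bad_def zk)
  qed
  then obtain t where t: "cmod t = 1" and tbad: "\<And>i. i \<in> F \<times> {..<m} \<Longrightarrow> t \<notin> bad i"
    using avoid_on_circle[OF finite_cartesian_product[OF F(1) finite_lessThan]] by blast
  have tt: "cnj t * t = 1" using t by (metis complex_norm_square mult.commute of_real_1 one_power2)
  have sq: "complex_of_real (sqrt (real m)) * complex_of_real (sqrt (real m)) = of_nat m"
    by (simp flip: of_real_mult)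
  have "braket (n t k) (n t k') = (if k = k' then 1 else 0)" if "k < m" "k' < m" for k k'
  proof -
    have ne: "braket (n t k) (e l) = cnj (c t k l)" if "l < m" for l
      using ip_e[OF that] braket_cnj[OF ec[OF that] nc] by simp
    have "braket (n t k) (n t k') = (\<Sum>l<m. c t k' l * cnj (c t k l))"
      unfolding ip[OF nc] by (intro sum.cong) (auto simp: ne)
    also have "\<dots> = (\<Sum>l<m. cnj (\<omega> k ^ l) * \<omega> k' ^ l / of_nat m)"
    proof (intro sum.cong refl)
      fix l
      have "c t k' l * cnj (c t k l) = cnj (\<omega> k ^ l) * \<omega> k' ^ l * (cnj t * t) ^ l
          / (complex_of_real (sqrt (real m)) * complex_of_real (sqrt (real m)))"
        by (simp add: c_def power_mult_distrib mult_ac)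
      then show "c t k' l * cnj (c t k l) = cnj (\<omega> k ^ l) * \<omega> k' ^ l / of_nat m"
        unfolding tt sq by simp
    qed
    also have "\<dots> = (if k = k' then 1 else 0)"
      using roots_of_unity_orthogonal[OF that] m
      by (simp add: \<omega>_def flip: sum_divide_distrib)
    finally show ?thesis .
  qed
  then have 1: "on_seq d (d - 2) (n t)" using nc by (auto simp: on_seq_def m_def)
  have 2: "braket p (n t k) = 0 \<and> braket q (n t k) = 0" for k
    using ip[OF p(1)] ip[OF q(1)] pe by simp
  have 3: "braket z (n t k) \<noteq> 0" if "k < d - 2" "z \<in> F" for k z
  proof -
    have z: "z \<in> carrier_vec d" using that F by auto
    have eq: "braket z (n t k) = (\<Sum>l<m. \<omega> k ^ l * braket z (e l) * t ^ l) / complex_of_real (sqrt (real m))"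
      unfolding ip[OF z] c_def sum_divide_distrib by (intro sum.cong) auto
    have "{..<m} = {..m - 1}" using m(1) by auto
    moreover have "(z, k) \<in> F \<times> {..<m}" using that by (simp add: m_def)
    ultimately have "(\<Sum>l<m. \<omega> k ^ l * braket z (e l) * t ^ l) \<noteq> 0"
      using tbad[of "(z, k)"] by (simp add: bad_def)
    then show ?thesis using eq m(1) by simp
  qed
  show ?thesis by (rule that[OF 1 2 3])
qed

text \<open>\<open>K\<close> lists the coordinates of all vectors that are going to be built in the
  frame \<open>p, q, n\<close>, so a single \<open>n\<close> serves them all. Multiplying a generic
  normal by a phase makes each overlap an affine function of that phase, with nonzero slope because
  \<open>c\<close> is nonzero; each condition thus excludes at most one phase.\<close>

lemma generic_third:
  assumes p: "p \<in> carrier_vec d" "braket p p = 1" and q: "q \<in> carrier_vec d" "braket q q = 1"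
    and pq: "braket p q = 0" and d: "d \<ge> 3"
    and F: "finite F" "F \<subseteq> carrier_vec d" "F \<inter> span2 p q = {}"
    and K: "finite K" "\<And>a b c. (a, b, c) \<in> K \<Longrightarrow> c \<noteq> 0"
  obtains n where "n \<in> carrier_vec d" "braket n n = 1" "braket p n = 0" "braket q n = 0"
    "\<And>z a b c. z \<in> F \<Longrightarrow> (a, b, c) \<in> K \<Longrightarrow> braket z (a \<cdot>\<^sub>v p + b \<cdot>\<^sub>v q + c \<cdot>\<^sub>v n) \<noteq> 0"
proof -
  obtain N where N: "on_seq d (d - 2) N"
    "\<And>k. k < d - 2 \<Longrightarrow> braket p (N k) = 0 \<and> braket q (N k) = 0"
    "\<And>k z. k < d - 2 \<Longrightarrow> z \<in> F \<Longrightarrow> braket z (N k) \<noteq> 0"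
    using generic_completion[OF p q pq d F] by metis
  define n where "n = N 0"
  have n: "n \<in> carrier_vec d" "braket n n = 1" "braket p n = 0" "braket q n = 0"
    and nz: "\<And>z. z \<in> F \<Longrightarrow> braket z n \<noteq> 0"
    using N d by (auto simp: n_def on_seq_def)
  define bad where "bad = (\<lambda>(z, a, b, c). {t. a * braket z p + b * braket z q + c * t * braket z n = 0})"
  have "finite (bad i)" if i: "i \<in> F \<times> K" for i
  proof -
    obtain z a b c where zk: "i = (z, a, b, c)" "z \<in> F" "(a, b, c) \<in> K" using i by auto
    have "bad i \<subseteq> {- (a * braket z p + b * braket z q) / (c * braket z n)}"
      using nz[OF zk(2)] K(2)[OF zk(3)] by (auto simp: bad_def zk field_simps eq_neg_iff_add_eq_0)
    then show ?thesis using finite_subset by blast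
  qed
  then obtain t where t: "cmod t = 1" and tbad: "\<And>i. i \<in> F \<times> K \<Longrightarrow> t \<notin> bad i"
    using avoid_on_circle[OF finite_cartesian_product[OF F(1) K(1)]] by blast
  have tt: "cnj t * t = 1" using t by (metis complex_norm_square mult.commute of_real_1 one_power2)
  show ?thesis
  proof
    show "t \<cdot>\<^sub>v n \<in> carrier_vec d" using n by simp
    show "braket (t \<cdot>\<^sub>v n) (t \<cdot>\<^sub>v n) = 1" "braket p (t \<cdot>\<^sub>v n) = 0" "braket q (t \<cdot>\<^sub>v n) = 0"
      using n p q tt by (auto simp: braket_simps[where d = d] mult.commute)
    fix z a b c assume zk: "z \<in> F" "(a, b, c) \<in> K"
    then have z: "z \<in> carrier_vec d" using F by auto
    have "braket z (a \<cdot>\<^sub>v p + b \<cdot>\<^sub>v q + c \<cdot>\<^sub>v (t \<cdot>\<^sub>v n))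
        = a * braket z p + b * braket z q + c * t * braket z n"
      using n p q z by (simp add: braket_simps[where d = d])
    then show "braket z (a \<cdot>\<^sub>v p + b \<cdot>\<^sub>v q + c \<cdot>\<^sub>v (t \<cdot>\<^sub>v n)) \<noteq> 0"
      using tbad[of "(z, a, b, c)"] zk by (auto simp: bad_def)
  qed
qed

section \<open>Colorings and the completion of a plane to a basis\<close>

text \<open>A coloring is represented by the set \<open>A\<close> of vectors of value 1.\<close>

definition col :: "nat \<Rightarrow> complex vec set \<Rightarrow> complex vec set \<Rightarrow> bool" where
  "col d S A \<longleftrightarrow> A \<subseteq> S \<and> (\<forall>x\<in>A. \<forall>y\<in>A. x \<noteq> y \<longrightarrow> \<not> orthogonal_vecs x y) \<and>
     (\<forall>C. is_clique S orthogonal_vecs C \<and> card C = d \<longrightarrow> C \<inter> A \<noteq> {})"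

text \<open>Cliques of fixed size \<open>d\<close> survive an enlargement of the set. Hence what is
  forced at an intermediate stage stays forced in every later one.\<close>

lemma col_restrict:
  assumes "col d S' A" "S \<subseteq> S'"
  shows "col d S (A \<inter> S)"
  using assms unfolding col_def is_clique_def by (auto 0 4)

text \<open>Parallel nonzero vectors are orthogonal to the same vectors. Non-parallelism is thus
  always proved by a witness \<open>r\<close> orthogonal to exactly one of the two.\<close>

lemma unit_not_parallel:
  assumes "u \<in> carrier_vec d" "v \<in> carrier_vec d" "braket u u = 1" "r \<in> carrier_vec d"
    "(braket r u = 0) \<noteq> (braket r v = 0)"
  shows "\<not> (\<exists>c. u = c \<cdot>\<^sub>v v)"
proof
  assume "\<exists>c. u = c \<cdot>\<^sub>v v"
  then obtain c where u: "u = c \<cdot>\<^sub>v v" by blast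
  then have "c \<noteq> 0" using assms(2,3) by (auto simp: braket_simps[where d = d])
  then show False using assms u by (simp add: braket_simps[where d = d])
qed

lemma vector_set_Un:
  assumes S: "vector_set d S" and X: "vector_set d X"
    and sep: "\<And>x z. x \<in> X \<Longrightarrow> z \<in> S \<Longrightarrow> \<exists>r\<in>carrier_vec d. (braket r x = 0) \<noteq> (braket r z = 0)"
  shows "vector_set d (S \<union> X)" "S \<inter> X = {}"
proof -
  have "\<not> (\<exists>c. x = c \<cdot>\<^sub>v z) \<and> \<not> (\<exists>c. z = c \<cdot>\<^sub>v x)" if xz: "x \<in> X" "z \<in> S" for x z
  proof -
    obtain r where "r \<in> carrier_vec d" "(braket r x = 0) \<noteq> (braket r z = 0)" using sep[OF xz] by blast
    moreover have "x \<in> carrier_vec d" "braket x x = 1" "z \<in> carrier_vec d" "braket z z = 1"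
      using S X xz by (auto simp: vector_set_def)
    ultimately show ?thesis using unit_not_parallel by metis
  qed
  note sepXS = this
  have S': "finite S" "S \<subseteq> carrier_vec d" "\<forall>v\<in>S. braket v v = 1"
      "\<forall>u\<in>S. \<forall>v\<in>S. u \<noteq> v \<longrightarrow> \<not> (\<exists>c. u = c \<cdot>\<^sub>v v)"
    and X': "finite X" "X \<subseteq> carrier_vec d" "\<forall>v\<in>X. braket v v = 1"
      "\<forall>u\<in>X. \<forall>v\<in>X. u \<noteq> v \<longrightarrow> \<not> (\<exists>c. u = c \<cdot>\<^sub>v v)"
    using S X by (simp_all add: vector_set_def)
  have "\<not> (\<exists>c. x = c \<cdot>\<^sub>v z)" if "x \<in> S \<union> X" "z \<in> S \<union> X" "x \<noteq> z" for x z
    using that S'(4) X'(4) sepXS by (elim UnE) simp_all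
  then show "vector_set d (S \<union> X)"
    using S'(1-3) X'(1-3) unfolding vector_set_def
    by (intro conjI ballI impI) (simp, simp, (metis Un_iff), blast)
  show "S \<inter> X = {}" using sep by blast
qed

lemma vector_setI:
  assumes "finite X" "X \<subseteq> carrier_vec d" "\<And>x. x \<in> X \<Longrightarrow> braket x x = 1"
    "\<And>x y. x \<in> X \<Longrightarrow> y \<in> X \<Longrightarrow> x \<noteq> y \<Longrightarrow> \<exists>r\<in>carrier_vec d. (braket r x = 0) \<noteq> (braket r y = 0)"
  shows "vector_set d X"
proof -
  have "\<not> (\<exists>c. x = c \<cdot>\<^sub>v y)" if xy: "x \<in> X" "y \<in> X" "x \<noteq> y" for x y
  proof -
    obtain r where r: "r \<in> carrier_vec d" "(braket r x = 0) \<noteq> (braket r y = 0)"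
      using assms(4)[OF xy] by blast
    show ?thesis
      by (rule unit_not_parallel[OF _ _ assms(3)[OF xy(1)] r]) (use xy assms(2) in auto)
  qed
  then show ?thesis using assms(1-3) by (simp add: vector_set_def)
qed

text \<open>Completing \<open>p, q\<close> to a basis turns the geometric fact that \<open>u\<close>
  lies in their plane into an implication between values: the new vectors are orthogonal to
  \<open>u\<close>, so if \<open>u\<close> has value 1, the basis must take its value 1 at
  \<open>p\<close> or \<open>q\<close>. Nothing else is forced, since this basis is the only new
  clique of size \<open>d\<close>. \<open>Fpq\<close> keeps old vectors from being parallel to new
  ones, which are orthogonal to both \<open>p\<close> and \<open>q\<close>.\<close>

lemma complete_plane:
  assumes d: "d \<ge> 3" and S: "vector_set d S" and mem: "p \<in> S" "q \<in> S" "u \<in> S"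
    and pq: "braket p q = 0" and u: "u \<in> span2 p q" "braket p u \<noteq> 0" "braket q u \<noteq> 0"
    and F: "finite F" "F \<subseteq> carrier_vec d" "F \<inter> span2 p q = {}" "S - {u, p, q} \<subseteq> F"
    and Fpq: "\<And>z. z \<in> F \<Longrightarrow> braket p z \<noteq> 0 \<or> braket q z \<noteq> 0"
  obtains X where "finite X" "vector_set d (S \<union> X)"
    "\<And>x z. x \<in> X \<Longrightarrow> z \<in> F \<Longrightarrow> braket z x \<noteq> 0"
    "\<And>x. x \<in> X \<Longrightarrow> braket p x = 0 \<and> braket q x = 0"
    "\<And>A. col d (S \<union> X) A \<Longrightarrow> u \<in> A \<Longrightarrow> p \<in> A \<or> q \<in> A"
    "\<And>A. col d S A \<Longrightarrow> (u \<in> A \<longrightarrow> p \<in> A \<or> q \<in> A) \<Longrightarrow> \<exists>A'. col d (S \<union> X) A' \<and> A' \<inter> S = A"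
proof -
  have Sc: "z \<in> carrier_vec d" "braket z z = 1" if "z \<in> S" for z
    using S that by (auto simp: vector_set_def)
  note p = Sc[OF mem(1)] and q = Sc[OF mem(2)] and uc = Sc[OF mem(3)]
  have up: "braket u p \<noteq> 0" "braket u q \<noteq> 0" using u p q uc braket_cnj by (metis complex_cnj_zero_iff)+
  have qp: "braket q p = 0" using braket_cnj[OF p(1) q(1)] pq by simp
  have ne: "p \<noteq> q" "u \<noteq> p" "u \<noteq> q" using pq u p q qp by auto
  obtain n where n: "on_seq d (d - 2) n"
    and npq: "\<And>k. k < d - 2 \<Longrightarrow> braket p (n k) = 0 \<and> braket q (n k) = 0"
    and nF: "\<And>k z. k < d - 2 \<Longrightarrow> z \<in> F \<Longrightarrow> braket z (n k) \<noteq> 0"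
    using generic_completion[OF p q pq d F(1-3)] by metis
  define X where "X = n ` {..<d - 2}"
  have Xc: "x \<in> carrier_vec d" "braket x x = 1" if "x \<in> X" for x
    using n that by (auto simp: X_def on_seq_def)
  have Xpq: "braket p x = 0" "braket q x = 0" if "x \<in> X" for x using npq that by (auto simp: X_def)
  have XF: "braket z x \<noteq> 0" if "x \<in> X" "z \<in> F" for x z using nF that by (auto simp: X_def)
  have XX: "braket x y = 0" if "x \<in> X" "y \<in> X" "x \<noteq> y" for x y
    using n that by (auto simp: X_def on_seq_def)
  have Xu: "braket u x = 0" if "x \<in> X" for x
  proof -
    have "braket x p = 0" "braket x q = 0"
      using Xpq[OF that] braket_cnj[OF p(1) Xc(1)[OF that]] braket_cnj[OF q(1) Xc(1)[OF that]] by auto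
    then have "braket x u = 0" using span2_orth u p q Xc[OF that] by blast
    then show ?thesis using braket_cnj[OF Xc(1)[OF that] uc(1)] by simp
  qed
  have inj: "inj_on n {..<d - 2}"
    using n by (auto simp: inj_on_def on_seq_def) (metis zero_neq_one)
  have finX: "finite X" and cardX: "card X = d - 2"
    using inj by (auto simp: X_def card_image)
  have Xvs: "vector_set d X"
    by (rule vector_setI) (use finX Xc XX in \<open>auto intro!: bexI\<close>)
  have Spq: "braket p z \<noteq> 0 \<or> braket q z \<noteq> 0" if "z \<in> S" for z
    using that F(4) Fpq p q u by (cases "z \<in> {u, p, q}") auto
  have SX: "vector_set d (S \<union> X)" "S \<inter> X = {}"
  proof -
    have "\<exists>r\<in>carrier_vec d. (braket r x = 0) \<noteq> (braket r z = 0)" if "x \<in> X" "z \<in> S" for x z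
      using Spq[OF that(2)] Xpq[OF that(1)] p q by auto
    from vector_set_Un[OF S Xvs this] show "vector_set d (S \<union> X)" "S \<inter> X = {}" by auto
  qed
  have orth_iff: "orthogonal_vecs z x \<longleftrightarrow> z \<in> {u, p, q}" "orthogonal_vecs x z \<longleftrightarrow> z \<in> {u, p, q}"
    if "z \<in> S" "x \<in> X" for z x
  proof -
    show "orthogonal_vecs z x \<longleftrightarrow> z \<in> {u, p, q}"
      using that F(4) XF Xpq Xu by (auto simp: orthogonal_vecs_def)
    then show "orthogonal_vecs x z \<longleftrightarrow> z \<in> {u, p, q}"
      using orthogonal_commute Sc Xc that by blast
  qed
  have clique: "is_clique (S \<union> X) orthogonal_vecs (insert p (insert q X))"
    using mem pq qp XX orth_iff by (auto simp: is_clique_def orthogonal_vecs_def)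
  have card: "card (insert p (insert q X)) = d"
    using ne mem SX(2) finX cardX d by (subst card_insert_disjoint; auto)+
  show ?thesis
  proof
    show "finite X" by fact
    show "vector_set d (S \<union> X)" by fact
    show "braket z x \<noteq> 0" if "x \<in> X" "z \<in> F" for x z using XF that .
    show "braket p x = 0 \<and> braket q x = 0" if "x \<in> X" for x using Xpq that by auto
  next
    fix A assume A: "col d (S \<union> X) A" "u \<in> A"
    then have "insert p (insert q X) \<inter> A \<noteq> {}" using clique card unfolding col_def by blast
    moreover have "x \<notin> A" if "x \<in> X" for x
    proof
      assume "x \<in> A"
      moreover have "u \<noteq> x" using that mem(3) SX(2) by blast
      moreover have "orthogonal_vecs u x" using orth_iff(1)[OF mem(3) that] by simp
      ultimately show False using A unfolding col_def by blast
    qed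
    ultimately show "p \<in> A \<or> q \<in> A" by auto
  next
    fix A assume A: "col d S A" and uA: "u \<in> A \<longrightarrow> p \<in> A \<or> q \<in> A"
    have AS: "A \<subseteq> S" using A by (simp add: col_def)
    \<comment> \<open>If neither \<open>p\<close> nor \<open>q\<close> has value 1, some new vector
      must. \<open>n 0\<close> is safe: its only old neighbors are \<open>u\<close>,
      \<open>p\<close>, \<open>q\<close>, and by \<open>uA\<close> all three have value 0.\<close>
    define A' where "A' = (if p \<in> A \<or> q \<in> A then A else insert (n 0) A)"
    have n0: "n 0 \<in> X" using d by (auto simp: X_def)
    have "C \<inter> A' \<noteq> {}" if C: "is_clique (S \<union> X) orthogonal_vecs C" "card C = d" for C
    proof (cases "C \<subseteq> S")
      case True
      then have "is_clique S orthogonal_vecs C" using C by (auto simp: is_clique_def)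
      then show ?thesis using A C unfolding col_def A'_def by auto
    next
      case False
      then obtain x where x: "x \<in> C" "x \<in> X" "x \<notin> S" using C by (auto simp: is_clique_def)
      have adj: "orthogonal_vecs y z" if "y \<in> C" "z \<in> C" "y \<noteq> z" for y z
        using C(1) that by (simp add: is_clique_def)
      have "z \<in> {u, p, q}" if z: "z \<in> C \<inter> S" for z
      proof -
        have "z \<noteq> x" using z x by auto
        then show ?thesis using adj[of z x] z x orth_iff(1)[of z x] by simp
      qed
      moreover have "\<not> (u \<in> C \<and> p \<in> C)" "\<not> (u \<in> C \<and> q \<in> C)"
        using adj[of u p] adj[of u q] ne up by (auto simp: orthogonal_vecs_def)
      ultimately have sub: "C \<inter> S \<subseteq> {u} \<or> C \<inter> S \<subseteq> {p, q}" by blast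
      have CX: "C = (C \<inter> S) \<union> (C \<inter> X)" using C by (auto simp: is_clique_def)
      have finC: "finite C" using C(2) d by (intro card_ge_0_finite) simp
      have "card (C \<inter> S \<union> C \<inter> X) = card (C \<inter> S) + card (C \<inter> X)"
        using finC SX(2) by (intro card_Un_disjoint) auto
      then have cC: "d = card (C \<inter> S) + card (C \<inter> X)" using CX C(2) by simp
      \<comment> \<open>At most \<open>d - 2\<close> members of the clique are new, so at least two
        are old. This rules out \<open>{u}\<close> and leaves the completed basis itself.\<close>
      have le: "card (C \<inter> X) \<le> d - 2"
        using card_mono[OF finX, of "C \<inter> X"] cardX by simp
      have "card (C \<inter> S) \<ge> 2" using cC le d by simp
      then have sub2: "C \<inter> S \<subseteq> {p, q}" using sub card_mono[of "{u}" "C \<inter> S"] by auto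
      then have eq: "C \<inter> S = {p, q}"
        using \<open>card (C \<inter> S) \<ge> 2\<close> ne by (intro card_seteq) auto
      then have "card (C \<inter> X) = card X" using cC cardX ne d by simp
      then have "X \<subseteq> C" using card_subset_eq[OF finX, of "C \<inter> X"] by auto
      then show ?thesis using eq n0 by (auto simp: A'_def)
    qed
    moreover have "\<not> orthogonal_vecs x y" if xy: "x \<in> A'" "y \<in> A'" "x \<noteq> y" for x y
    proof -
      have *: "\<not> orthogonal_vecs z (n 0) \<and> \<not> orthogonal_vecs (n 0) z" if "z \<in> A" "\<not> (p \<in> A \<or> q \<in> A)" for z
        using orth_iff[OF _ n0, of z] that uA AS by auto
      show ?thesis using xy * A unfolding A'_def col_def by (auto split: if_splits)
    qed
    moreover have "A' \<subseteq> S \<union> X" "A' \<inter> S = A"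
      using AS n0 SX(2) by (auto simp: A'_def)
    ultimately show "\<exists>A'. col d (S \<union> X) A' \<and> A' \<inter> S = A" unfolding col_def by blast
  qed
qed

section \<open>Coordinates in a three-dimensional frame\<close>

text \<open>Real coefficients suffice once the phase of the overlap is absorbed into the frame;
  orthogonality then becomes a real polynomial equation.\<close>

definition lin3 :: "complex vec \<Rightarrow> complex vec \<Rightarrow> complex vec \<Rightarrow> real \<Rightarrow> real \<Rightarrow> real \<Rightarrow> complex vec" where
  "lin3 p q n a b c = complex_of_real a \<cdot>\<^sub>v p + complex_of_real b \<cdot>\<^sub>v q + complex_of_real c \<cdot>\<^sub>v n"

definition frame3 :: "nat \<Rightarrow> complex vec \<Rightarrow> complex vec \<Rightarrow> complex vec \<Rightarrow> bool" where
  "frame3 d p q n \<longleftrightarrow> p \<in> carrier_vec d \<and> q \<in> carrier_vec d \<and> n \<in> carrier_vec d \<and>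
     braket p p = 1 \<and> braket q q = 1 \<and> braket n n = 1 \<and>
     braket p q = 0 \<and> braket p n = 0 \<and> braket q n = 0"

lemma lin3_carrier: "frame3 d p q n \<Longrightarrow> lin3 p q n a b c \<in> carrier_vec d"
  by (simp add: lin3_def frame3_def)

lemma lin3_braket:
  assumes "frame3 d p q n"
  shows "braket (lin3 p q n a b c) (lin3 p q n a' b' c') = complex_of_real (a * a' + b * b' + c * c')"
proof -
  have f: "p \<in> carrier_vec d" "q \<in> carrier_vec d" "n \<in> carrier_vec d"
     "braket p p = 1" "braket q q = 1" "braket n n = 1"
     "braket p q = 0" "braket p n = 0" "braket q n = 0"
    using assms by (auto simp: frame3_def)
  have "braket q p = 0" "braket n p = 0" "braket n q = 0"
    using f braket_cnj by (metis complex_cnj_zero)+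
  then show ?thesis using f by (simp add: lin3_def braket_simps[where d = d])
qed

lemma lin3_span2:
  assumes "frame3 d p q n" "a3 = l * a1 + m * a2" "b3 = l * b1 + m * b2" "c3 = l * c1 + m * c2"
  shows "lin3 p q n a3 b3 c3 \<in> span2 (lin3 p q n a1 b1 c1) (lin3 p q n a2 b2 c2)"
proof -
  have f: "p \<in> carrier_vec d" "q \<in> carrier_vec d" "n \<in> carrier_vec d"
    using assms(1) by (auto simp: frame3_def)
  have "lin3 p q n a3 b3 c3 = complex_of_real l \<cdot>\<^sub>v lin3 p q n a1 b1 c1 + complex_of_real m \<cdot>\<^sub>v lin3 p q n a2 b2 c2"
    using f by (auto simp: lin3_def assms(2-4) algebra_simps)
  then show ?thesis unfolding span2_def by blast
qed

text \<open>Gram-Schmidt, with \<open>p\<close> equal to \<open>v\<close> up to the phase that makes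
  the overlap with \<open>u\<close> real and positive. The inclusion of planes carries assumptions
  on \<open>F\<close> over from \<open>u, v\<close> to \<open>p, q\<close>.\<close>

lemma decompose_pair:
  assumes u: "u \<in> carrier_vec d" "braket u u = 1" and v: "v \<in> carrier_vec d" "braket v v = 1"
    and b: "braket v u \<noteq> 0" "cmod (braket v u) < 1"
  obtains \<zeta> p q s where "\<zeta> \<noteq> 0" "v = \<zeta> \<cdot>\<^sub>v p" "p \<in> carrier_vec d" "braket p p = 1"
    "q \<in> carrier_vec d" "braket q q = 1" "braket p q = 0"
    "s > 0" "(cmod (braket v u))\<^sup>2 + s\<^sup>2 = 1"
    "u = complex_of_real (cmod (braket v u)) \<cdot>\<^sub>v p + complex_of_real s \<cdot>\<^sub>v q"
    "span2 p q \<subseteq> span2 u v"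
proof -
  define c where "c = cmod (braket v u)"
  define \<zeta> where "\<zeta> = cnj (braket v u) / complex_of_real c"
  define p where "p = (1 / \<zeta>) \<cdot>\<^sub>v v"
  define s where "s = sqrt (1 - c\<^sup>2)"
  define q where "q = (1 / complex_of_real s) \<cdot>\<^sub>v (u + (- complex_of_real c) \<cdot>\<^sub>v p)"
  have c: "c > 0" "c < 1" using b by (auto simp: c_def)
  have z: "\<zeta> \<noteq> 0" using b c by (simp add: \<zeta>_def)
  have "cmod \<zeta> = 1" using c b by (simp add: \<zeta>_def norm_divide c_def)
  then have zz: "\<zeta> * cnj \<zeta> = 1" by (metis complex_norm_square of_real_1 one_power2)
  then have iz: "1 / \<zeta> = cnj \<zeta>" using z by (simp add: field_simps)
  have "c\<^sup>2 < 1" using c by (simp add: power_less_one_iff)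
  then have s: "s > 0" "c\<^sup>2 + s\<^sup>2 = 1" by (auto simp: s_def)
  have p: "p \<in> carrier_vec d" "braket p p = 1"
    using v zz by (auto simp: p_def iz braket_simps[where d = d] mult.commute)
  have vp: "v = \<zeta> \<cdot>\<^sub>v p" using z by (auto simp: p_def smult_smult_assoc)
  have "braket v u * cnj (braket v u) = (complex_of_real c)\<^sup>2"
    by (simp add: c_def complex_norm_square[symmetric])
  then have pu: "braket p u = complex_of_real c"
    using v u c(1) b(1) by (simp add: p_def iz braket_simps[where d = d] \<zeta>_def field_simps power2_eq_square)
  then have up: "braket u p = complex_of_real c" using braket_cnj[OF p(1) u(1)] by simp
  have q: "q \<in> carrier_vec d" using u p by (simp add: q_def)
  have pq: "braket p q = 0" using u p pu by (simp add: q_def braket_simps[where d = d])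
  have sc: "(complex_of_real s)\<^sup>2 = 1 - (complex_of_real c)\<^sup>2"
    using s(2) by (metis add_diff_cancel_left' of_real_1 of_real_diff of_real_power)
  have qq: "braket q q = 1"
    using u p pu up s(1) sc by (simp add: q_def braket_simps[where d = d] field_simps power2_eq_square)
  have uq: "u = complex_of_real c \<cdot>\<^sub>v p + complex_of_real s \<cdot>\<^sub>v q"
    using u p s(1) by (intro eq_vecI) (auto simp: q_def field_simps)
  have sp: "span2 p q \<subseteq> span2 u v"
  proof
    fix x assume "x \<in> span2 p q"
    then obtain \<alpha> \<beta> where x: "x = \<alpha> \<cdot>\<^sub>v p + \<beta> \<cdot>\<^sub>v q" by (auto simp: span2_def)
    have "x = (\<beta> / complex_of_real s) \<cdot>\<^sub>v u + ((\<alpha> - \<beta> * complex_of_real c / complex_of_real s) / \<zeta>) \<cdot>\<^sub>v v"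
      (is "_ = ?r")
    proof (rule eq_vecI)
      show "dim_vec x = dim_vec ?r" using x q u v by simp
      fix i assume "i < dim_vec ?r"
      then have i: "i < d" using v by simp
      have f1: "v $ i = \<zeta> * p $ i" using arg_cong[OF vp, of "\<lambda>v. v $ i"] i p by simp
      have f2: "q $ i = (u $ i - complex_of_real c * p $ i) / complex_of_real s"
        using i u p by (simp add: q_def)
      have f3: "x $ i = \<alpha> * p $ i + \<beta> * q $ i" using i p q x by simp
      have f4: "?r $ i = (\<beta> / complex_of_real s) * u $ i
          + ((\<alpha> - \<beta> * complex_of_real c / complex_of_real s) / \<zeta>) * v $ i"
        using i u v by simp
      show "x $ i = ?r $ i" unfolding f4 f3 f1 f2 using z by (simp add: algebra_simps diff_divide_distrib)
    qed
    then show "x \<in> span2 u v" unfolding span2_def by blast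
  qed
  show ?thesis
    by (rule that[OF z vp p q qq pq s(1) s(2)[unfolded c_def] uq[unfolded c_def] sp])
qed

text \<open>With \<open>t\<close> for the square of \<open>x\<close>, the equation is quadratic. The
  maximum of \<open>t * (3 - 2 * t)\<close> is 9/8, attained at 3/4, which is why the square of
  \<open>s\<close> has to reach 8/9. The smaller root lies strictly between 1/2 and 3/4, and this
  gives both final inequalities. \<open>k\<close> is the factor that normalizes \<open>g\<close> and
  \<open>h\<close>.\<close>

lemma clifton_parameters:
  fixes c s :: real
  assumes "c > 0" "s > 0" "c\<^sup>2 + s\<^sup>2 = 1" "c\<^sup>2 < 1 / 9"
  obtains x w k where "x > 0" "w > 0" "k > 0" "x\<^sup>2 + w\<^sup>2 = 1" "s\<^sup>2 * x\<^sup>2 * (3 - 2 * x\<^sup>2) = 1"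
    "k\<^sup>2 * (1 - s\<^sup>2 * x\<^sup>2) = 1" "x\<^sup>2 \<noteq> w\<^sup>2" "w\<^sup>2 \<noteq> c\<^sup>2 * x\<^sup>2"
proof -
  have c0: "c\<^sup>2 > 0" using assms(1) by simp
  have s2: "s\<^sup>2 > 8 / 9" "s\<^sup>2 < 1" using assms(3,4) c0 by linarith+
  define D where "D = sqrt (9 - 8 / s\<^sup>2)"
  have "8 / s\<^sup>2 < 9" "8 / s\<^sup>2 > 8" using s2 less_trans[OF _ s2(1), of 0] by (auto simp: field_simps)
  then have D: "D > 0" "D < 1" "D\<^sup>2 = 9 - 8 / s\<^sup>2" by (auto simp: D_def)
  define t where "t = (3 - D) / 4"
  have t: "1 / 2 < t" "t < 3 / 4" using D by (auto simp: t_def)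
  have "t * (3 - 2 * t) = 1 / s\<^sup>2" using D(3) by (simp add: t_def power2_eq_square field_simps)
  then have "s\<^sup>2 * (t * (3 - 2 * t)) = s\<^sup>2 * (1 / s\<^sup>2)" by simp
  then have eq: "s\<^sup>2 * t * (3 - 2 * t) = 1" using assms(2) by (simp add: mult.assoc)
  have "s\<^sup>2 * t < 1 * 1" using t s2 by (intro mult_strict_mono) auto
  then have st: "1 - s\<^sup>2 * t > 0" by simp
  have "c\<^sup>2 * t < 1 / 9 * 1" using t assms(4) c0 by (intro mult_strict_mono) auto
  then have ct: "1 - t \<noteq> c\<^sup>2 * t" using t by linarith
  show ?thesis
    by (rule that[of "sqrt t" "sqrt (1 - t)" "1 / sqrt (1 - s\<^sup>2 * t)"])
       (use t eq st ct in \<open>auto simp: power_divide\<close>)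
qed

section \<open>Clifton's gadget\<close>

lemma braket_eq_0_commute:
  assumes "u \<in> carrier_vec d" "v \<in> carrier_vec d"
  shows "braket u v = 0 \<longleftrightarrow> braket v u = 0"
  using braket_cnj[OF assms] by simp

lemma not_in_span2:
  assumes "p \<in> carrier_vec d" "q \<in> carrier_vec d" "r \<in> carrier_vec d"
    "braket r p = 0" "braket r q = 0" "\<And>x. x \<in> F \<Longrightarrow> braket r x \<noteq> 0"
  shows "F \<inter> span2 p q = {}"
  using span2_orth[OF assms(1-5)] assms(6) by auto

text \<open>Clifton's gadget. If \<open>u\<close> and \<open>v\<close> both have value 1, then \<open>a\<close> and \<open>b\<close> have value 0, which
  forces the orthogonal vectors \<open>g\<close> and \<open>h\<close> to have value 1. The new vectors form with \<open>v\<close> the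
  pentagon \<open>v, a, g, h, b\<close>; the vectors \<open>r\<^sub>1\<close>, \<open>r\<^sub>2\<close> only certify that other vectors lie outside
  the planes of \<open>g, a\<close> and of \<open>h, b\<close>.\<close>

lemma pentagon_gadget:
  assumes d: "d \<ge> 3" and S: "vector_set d S" and uv: "u \<in> S" "v \<in> S"
    and F: "finite F" "F \<subseteq> carrier_vec d" "S - {u, v} \<subseteq> F"
    and car: "a \<in> carrier_vec d" "b \<in> carrier_vec d" "g \<in> carrier_vec d" "h \<in> carrier_vec d"
      "r1 \<in> carrier_vec d" "r2 \<in> carrier_vec d"
    and unit: "braket a a = 1" "braket b b = 1" "braket g g = 1" "braket h h = 1"
    and zero: "braket g a = 0" "braket h b = 0" "braket v a = 0" "braket v b = 0" "braket g h = 0"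
      "braket r1 g = 0" "braket r1 a = 0" "braket r2 h = 0" "braket r2 b = 0"
    and span: "u \<in> span2 g a" "u \<in> span2 h b"
    and nzF: "\<And>z k. z \<in> F \<Longrightarrow> k \<in> {a, b, g, h, r1, r2} \<Longrightarrow> braket z k \<noteq> 0"
    and nz: "braket g u \<noteq> 0" "braket a u \<noteq> 0" "braket h u \<noteq> 0" "braket b u \<noteq> 0"
      "braket v g \<noteq> 0" "braket v h \<noteq> 0" "braket a b \<noteq> 0" "braket a h \<noteq> 0" "braket b g \<noteq> 0"
    and nz1: "braket r1 v \<noteq> 0" "braket r1 b \<noteq> 0" "braket r1 h \<noteq> 0" "braket r1 r2 \<noteq> 0" "braket a r2 \<noteq> 0"
    and nz2: "braket r2 v \<noteq> 0" "braket r2 a \<noteq> 0" "braket r2 g \<noteq> 0"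
  obtains X where "finite X" "vector_set d (S \<union> X)"
    "\<And>x z. x \<in> X \<Longrightarrow> z \<in> F \<Longrightarrow> braket z x \<noteq> 0"
    "\<And>A. col d (S \<union> X) A \<Longrightarrow> \<not> (u \<in> A \<and> v \<in> A)"
    "\<And>A. col d S A \<Longrightarrow> \<not> (u \<in> A \<and> v \<in> A) \<Longrightarrow> \<exists>A'. col d (S \<union> X) A' \<and> A' \<inter> S = A"
proof -
  have Sc: "z \<in> carrier_vec d" "braket z z = 1" if "z \<in> S" for z
    using S that by (auto simp: vector_set_def)
  note u = Sc[OF uv(1)] and v = Sc[OF uv(2)]
  note sym = braket_eq_0_commute[where d = d]
  have zero': "braket a g = 0" "braket b h = 0" "braket a v = 0" "braket b v = 0" "braket h g = 0"
    using zero sym car v by blast+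
  have nz': "braket u g \<noteq> 0" "braket u a \<noteq> 0" "braket u h \<noteq> 0" "braket u b \<noteq> 0"
      "braket g v \<noteq> 0" "braket h v \<noteq> 0" "braket b a \<noteq> 0" "braket h a \<noteq> 0" "braket g b \<noteq> 0"
    using nz sym car u v by blast+
  have nzF': "braket k z \<noteq> 0" if "z \<in> F" "k \<in> {a, b, g, h, r1, r2}" for z k
  proof -
    have "k \<in> carrier_vec d" "z \<in> carrier_vec d" using that car F by auto
    then show ?thesis using nzF[OF that] sym by blast
  qed
  define X0 where "X0 = {a, b, g, h}"
  define S1 where "S1 = S \<union> X0"
  define sep where "sep x y \<longleftrightarrow> (\<exists>r\<in>carrier_vec d. (braket r x = 0) \<noteq> (braket r y = 0))" for x y
  have sepI: "sep x y" "sep y x" if "r \<in> carrier_vec d" "braket r x = 0" "braket r y \<noteq> 0" for r x y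
    using that by (auto simp: sep_def)
  have "sep a b" "sep b a" "sep a g" "sep g a" "sep a h" "sep h a"
    "sep b g" "sep g b" "sep b h" "sep h b" "sep g h" "sep h g"
    using sepI[OF car(3), of a b] sepI[OF v(1), of a g] sepI[OF v(1), of a h] sepI[OF v(1), of b g]
      sepI[OF v(1), of b h] sepI[OF car(1), of g h] zero zero' nz nz' by blast+
  then have "sep x y" if "x \<in> X0" "y \<in> X0" "x \<noteq> y" for x y
    using that unfolding X0_def by (elim insertE emptyE) simp_all
  then have X0: "vector_set d X0"
    by (intro vector_setI) (use car unit in \<open>auto simp: X0_def sep_def\<close>)
  have S1: "vector_set d S1" "S \<inter> X0 = {}"
  proof -
    have "\<exists>r\<in>carrier_vec d. (braket r x = 0) \<noteq> (braket r z = 0)" if x: "x \<in> X0" and z: "z \<in> S" for x z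
    proof -
      consider "z \<in> F" | "z = u" | "z = v" using F(3) z by auto
      then have "sep a z \<and> sep b z \<and> sep g z \<and> sep h z"
      proof cases
        case 1
        have "braket g z \<noteq> 0" "braket a z \<noteq> 0" "braket h z \<noteq> 0" "braket b z \<noteq> 0"
          using nzF'[OF 1] by auto
        then show ?thesis using sepI(1) car zero(1,2) zero'(1,2) by blast
      next
        case 2
        then show ?thesis using sepI(1) car zero(1,2) zero'(1,2) nz by blast
      next
        case 3
        have "braket v v \<noteq> 0" using v by simp
        then show ?thesis
          using sepI(1)[OF v(1) zero(3)] sepI(1)[OF v(1) zero(4)]
            sepI(2)[OF car(2) zero'(4) nz(9)] sepI(2)[OF car(1) zero'(3) nz(8)] 3 by blast
      qed
      then show ?thesis using x unfolding X0_def sep_def[symmetric] by (elim insertE emptyE) simp_all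
    qed
    from vector_set_Un[OF S X0 this] show "vector_set d S1" "S \<inter> X0 = {}" by (auto simp: S1_def)
  qed
  have mem1: "g \<in> S1" "a \<in> S1" "h \<in> S1" "b \<in> S1" "u \<in> S1" "v \<in> S1"
    using uv by (auto simp: S1_def X0_def)
  \<comment> \<open>\<open>r2\<close> is included so that the vectors completing \<open>g, a\<close>
    have nonzero overlap with it; it can then certify that they lie outside the plane of
    \<open>h, b\<close>, which is completed next.\<close>
  define F1 where "F1 = F \<union> {v, b, h, r2}"
  have F1: "finite F1" "F1 \<subseteq> carrier_vec d" "S1 - {u, g, a} \<subseteq> F1"
    using F car v by (auto simp: F1_def S1_def X0_def)
  have F1s: "F1 \<inter> span2 g a = {}"
    by (rule not_in_span2[OF car(3) car(1) car(5)]) (use zero nz1 nzF' in \<open>auto simp: F1_def\<close>)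
  have F1p: "braket g z \<noteq> 0 \<or> braket a z \<noteq> 0" if "z \<in> F1" for z
    using that nz nz' nz1 nzF'[of z g] by (auto simp: F1_def)
  obtain X1 where X1: "finite X1" "vector_set d (S1 \<union> X1)"
    "\<And>x z. x \<in> X1 \<Longrightarrow> z \<in> F1 \<Longrightarrow> braket z x \<noteq> 0"
    "\<And>A. col d (S1 \<union> X1) A \<Longrightarrow> u \<in> A \<Longrightarrow> g \<in> A \<or> a \<in> A"
    "\<And>A. col d S1 A \<Longrightarrow> (u \<in> A \<longrightarrow> g \<in> A \<or> a \<in> A) \<Longrightarrow> \<exists>A'. col d (S1 \<union> X1) A' \<and> A' \<inter> S1 = A"
    using complete_plane[OF d S1(1) mem1(1,2,5) zero(1) span(1) nz(1,2) F1(1,2) F1s F1(3) F1p]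
    by metis
  define S2 where "S2 = S1 \<union> X1"
  have X1c: "X1 \<subseteq> carrier_vec d" using X1(2) by (auto simp: vector_set_def)
  have mem2: "h \<in> S2" "b \<in> S2" "u \<in> S2" using mem1 by (auto simp: S2_def)
  have S2: "vector_set d S2" using X1(2) by (simp add: S2_def)
  define F2 where "F2 = F \<union> {v, a, g} \<union> X1"
  have F2: "finite F2" "F2 \<subseteq> carrier_vec d" "S2 - {u, h, b} \<subseteq> F2"
    using F car v X1(1) X1c by (auto simp: F2_def S2_def S1_def X0_def)
  have "r2 \<in> F1" "h \<in> F1" by (auto simp: F1_def)
  then have X1nz: "braket r2 x \<noteq> 0" "braket h x \<noteq> 0" if "x \<in> X1" for x using X1(3) that by blast+
  have F2s: "F2 \<inter> span2 h b = {}"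
    by (rule not_in_span2[OF car(4) car(2) car(6)]) (use zero nz2 nzF' X1nz in \<open>auto simp: F2_def\<close>)
  have F2p: "braket h z \<noteq> 0 \<or> braket b z \<noteq> 0" if "z \<in> F2" for z
    using that nz nz' nzF'[of z h] X1nz by (auto simp: F2_def)
  obtain X2 where X2: "finite X2" "vector_set d (S2 \<union> X2)"
    "\<And>x z. x \<in> X2 \<Longrightarrow> z \<in> F2 \<Longrightarrow> braket z x \<noteq> 0"
    "\<And>A. col d (S2 \<union> X2) A \<Longrightarrow> u \<in> A \<Longrightarrow> h \<in> A \<or> b \<in> A"
    "\<And>A. col d S2 A \<Longrightarrow> (u \<in> A \<longrightarrow> h \<in> A \<or> b \<in> A) \<Longrightarrow> \<exists>A'. col d (S2 \<union> X2) A' \<and> A' \<inter> S2 = A"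
    using complete_plane[OF d S2 mem2 zero(2) span(2) nz(3,4) F2(1,2) F2s F2(3) F2p]
    by metis
  define X where "X = X0 \<union> X1 \<union> X2"
  have SX: "S \<union> X = S2 \<union> X2" by (auto simp: X_def S2_def S1_def)
  have neq: "a \<noteq> v" "b \<noteq> v" "g \<noteq> h" "a \<noteq> b" "a \<noteq> h" "b \<noteq> g" "v \<noteq> g" "v \<noteq> h"
    using zero zero' unit v nz nz' by auto
  show ?thesis
  proof
    show "finite X" using X1(1) X2(1) by (simp add: X_def X0_def)
    show "vector_set d (S \<union> X)" using X2(2) SX by simp
    show "braket z x \<noteq> 0" if "x \<in> X" "z \<in> F" for x z
      using that nzF X1(3)[of x z] X2(3)[of x z] by (auto simp: X_def X0_def F1_def F2_def)
  next
    fix A assume "col d (S \<union> X) A"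
    then have A: "col d (S2 \<union> X2) A" using SX by simp
    then have A': "col d (S1 \<union> X1) (A \<inter> S2)" using col_restrict[of d "S2 \<union> X2" A S2] by (simp add: S2_def)
    show "\<not> (u \<in> A \<and> v \<in> A)"
    proof
      assume uvA: "u \<in> A \<and> v \<in> A"
      have ind: "\<not> orthogonal_vecs x y" if "x \<in> A" "y \<in> A" "x \<noteq> y" for x y
        using A that by (auto simp: col_def)
      have "a \<notin> A" "b \<notin> A"
        using ind[of v a] ind[of v b] uvA zero neq by (auto simp: orthogonal_vecs_def)
      moreover have "h \<in> A \<or> b \<in> A" using X2(4)[OF A] uvA by blast
      moreover have "g \<in> A \<or> a \<in> A" using X1(4)[OF A'] uvA mem2 by auto
      ultimately show False using ind[of g h] zero neq by (auto simp: orthogonal_vecs_def)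
    qed
  next
    fix A assume A: "col d S A" and nuv: "\<not> (u \<in> A \<and> v \<in> A)"
    have AS: "A \<subseteq> S" using A by (simp add: col_def)
    \<comment> \<open>If \<open>u\<close> has value 1, then \<open>v\<close> has not, so its
      neighbors \<open>a\<close> and \<open>b\<close> may both take value 1, which satisfies the
      requirements of both planes. Otherwise none of the four vectors needs value 1.\<close>
    define A1 where "A1 = (if u \<in> A then A \<union> {a, b} else A)"
    have "\<not> orthogonal_vecs x y" if xy: "x \<in> A1" "y \<in> A1" "x \<noteq> y" for x y
    proof -
      have *: "\<not> orthogonal_vecs z k \<and> \<not> orthogonal_vecs k z" if "z \<in> A" "u \<in> A" "k \<in> {a, b}" for z k
      proof -
        have "z \<in> F \<or> z = u" using that AS F(3) nuv by auto
        then show ?thesis using that nzF[of z k] nzF'[of z k] nz nz' by (auto simp: orthogonal_vecs_def)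
      qed
      have "\<not> orthogonal_vecs a b" "\<not> orthogonal_vecs b a" using nz nz' by (auto simp: orthogonal_vecs_def)
      then show ?thesis using xy * A unfolding A1_def col_def by (auto split: if_splits)
    qed
    moreover have "C \<inter> A1 \<noteq> {}" if C: "is_clique S1 orthogonal_vecs C" "card C = d" for C
    proof (cases "C \<subseteq> S")
      case True
      then have "is_clique S orthogonal_vecs C" using C by (auto simp: is_clique_def)
      then show ?thesis using A C unfolding col_def A1_def by auto
    next
      case False
      have adj: "braket y z = 0" if "y \<in> C" "z \<in> C" "y \<noteq> z" for y z
        using C(1) that by (simp add: is_clique_def orthogonal_vecs_def)
      obtain k where k: "k \<in> C" "k \<in> X0" using False C by (auto simp: is_clique_def S1_def)
      have "z \<notin> F - X0 \<union> {u}" if "z \<in> C" for z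
      proof
        assume z: "z \<in> F - X0 \<union> {u}"
        then have "z \<noteq> k" using k S1(2) uv by auto
        then have "braket z k = 0" using adj that k by blast
        then show False using z k nzF[of z k] nz' by (auto simp: X0_def)
      qed
      moreover have "C \<subseteq> S1" using C by (simp add: is_clique_def)
      ultimately have sub: "C \<subseteq> {v, a, b, g, h}" using F(3) S1(2) by (auto simp: S1_def X0_def)
      \<comment> \<open>A pentagon contains no triangle, so as \<open>d >= 3\<close> the four
        vectors create no clique of size \<open>d\<close>.\<close>
      have "a \<notin> C \<or> b \<notin> C" "a \<notin> C \<or> h \<notin> C" "b \<notin> C \<or> g \<notin> C" "v \<notin> C \<or> g \<notin> C" "v \<notin> C \<or> h \<notin> C"
        using adj[of a b] adj[of a h] adj[of b g] adj[of v g] adj[of v h] nz zero neq unit v by auto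
      then have "C \<subseteq> {v, a} \<or> C \<subseteq> {v, b} \<or> C \<subseteq> {a, g} \<or> C \<subseteq> {b, h} \<or> C \<subseteq> {g, h}"
        using sub by blast
      then obtain y z where "C \<subseteq> {y, z}" by blast
      then have "card C \<le> card {y, z}" by (intro card_mono) simp_all
      also have "\<dots> \<le> 2" by (simp add: card_insert_if)
      finally have "card C \<le> 2" .
      then show ?thesis using C(2) d by simp
    qed
    moreover have "A1 \<subseteq> S1" "A1 \<inter> S = A"
      using AS S1(2) by (auto simp: A1_def S1_def X0_def)
    ultimately have "col d S1 A1" by (auto simp: col_def)
    moreover have "u \<in> A1 \<longrightarrow> g \<in> A1 \<or> a \<in> A1" using S1(2) uv by (auto simp: A1_def X0_def)
    ultimately obtain A2 where A2: "col d S2 A2" "A2 \<inter> S1 = A1" using X1(5) S2_def by blast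
    moreover have "u \<in> A2 \<longrightarrow> b \<in> A2"
    proof
      assume "u \<in> A2"
      then have "u \<in> A1" using A2 mem1 by auto
      then have "b \<in> A1" using S1(2) uv by (auto simp: A1_def X0_def split: if_splits)
      then show "b \<in> A2" using A2 by auto
    qed
    ultimately obtain A3 where A3: "col d (S2 \<union> X2) A3" "A3 \<inter> S2 = A2" using X2(5) by blast
    have "S \<subseteq> S1" "S1 \<subseteq> S2" by (auto simp: S1_def S2_def)
    then have "A3 \<inter> S = A" using A3(2) A2(2) \<open>A1 \<inter> S = A\<close> by blast
    then show "\<exists>A'. col d (S \<union> X) A' \<and> A' \<inter> S = A" using A3(1) SX by auto
  qed
qed

text \<open>The coordinates below refer to an orthonormal frame \<open>p, q, n\<close> with \<open>u = c p + s q\<close>, where \<open>p\<close> is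
  \<open>v\<close> up to a phase and \<open>n\<close> is generic. The orthogonality of \<open>g\<close> and \<open>h\<close> is the equation
  \<open>s\<^sup>2 x\<^sup>2 (3 - 2 x\<^sup>2) = 1\<close>, which has a solution because \<open>c\<^sup>2 < 1 / 9\<close>.\<close>

lemma exclude_small:
  assumes d: "d \<ge> 3" and S: "vector_set d S" and uv: "u \<in> S" "v \<in> S"
    and ov: "braket v u \<noteq> 0" "(cmod (braket v u))\<^sup>2 < 1 / 9"
    and F: "finite F" "F \<subseteq> carrier_vec d" "S - {u, v} \<subseteq> F"
    and Fspan: "\<And>z. z \<in> F \<Longrightarrow> z \<in> span2 u v \<Longrightarrow> braket v z = 0 \<and> braket u z \<noteq> 0"
  obtains X where "finite X" "vector_set d (S \<union> X)"
    "\<And>x z. x \<in> X \<Longrightarrow> z \<in> F \<Longrightarrow> braket z x \<noteq> 0"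
    "\<And>A. col d (S \<union> X) A \<Longrightarrow> \<not> (u \<in> A \<and> v \<in> A)"
    "\<And>A. col d S A \<Longrightarrow> \<not> (u \<in> A \<and> v \<in> A) \<Longrightarrow> \<exists>A'. col d (S \<union> X) A' \<and> A' \<inter> S = A"
proof -
  have u: "u \<in> carrier_vec d" "braket u u = 1" and v: "v \<in> carrier_vec d" "braket v v = 1"
    using S uv by (auto simp: vector_set_def)
  define c where "c = cmod (braket v u)"
  have "(cmod (braket v u))\<^sup>2 < 1\<^sup>2" using ov(2) by simp
  then have ov1: "cmod (braket v u) < 1" using power_less_imp_less_base[of _ 2 "1::real"] by simp
  obtain \<zeta> p q s where zt: "\<zeta> \<noteq> 0" "v = \<zeta> \<cdot>\<^sub>v p" and p: "p \<in> carrier_vec d" "braket p p = 1"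
    and q: "q \<in> carrier_vec d" "braket q q = 1" and pq: "braket p q = 0"
    and s: "s > 0" "c\<^sup>2 + s\<^sup>2 = 1"
    and ueq: "u = complex_of_real c \<cdot>\<^sub>v p + complex_of_real s \<cdot>\<^sub>v q"
    and sp: "span2 p q \<subseteq> span2 u v"
    using decompose_pair[OF u v ov(1) ov1] unfolding c_def[symmetric] by metis
  have c: "c > 0" "c\<^sup>2 < 1 / 9" using ov by (auto simp: c_def)
  obtain x w k where x: "x > 0" and w: "w > 0" and k: "k > 0" and xw: "x\<^sup>2 + w\<^sup>2 = 1"
    and clifton: "s\<^sup>2 * x\<^sup>2 * (3 - 2 * x\<^sup>2) = 1" and ks: "k\<^sup>2 * (1 - s\<^sup>2 * x\<^sup>2) = 1"
    and neq: "x\<^sup>2 \<noteq> w\<^sup>2" "w\<^sup>2 \<noteq> c\<^sup>2 * x\<^sup>2"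
    using clifton_parameters[OF c(1) s(1,2) c(2)] by metis
  \<comment> \<open>Coordinates of \<open>a\<close>, \<open>b\<close>, \<open>h\<close>,
    \<open>g\<close>, \<open>r1\<close>, \<open>r2\<close> up to order, fixed before
    \<open>n\<close> is chosen so that \<open>n\<close> can be generic for all of them.\<close>
  define K where "K = {(0, x, w), (0, x, - w), (k * c, k * s * w\<^sup>2, - (k * s * x * w)),
    (k * c, k * s * w\<^sup>2, k * s * x * w), (s * w, - (c * w), c * x), (s * w, - (c * w), - (c * x))}"
  define K' where "K' = (\<lambda>(a, b, e). (complex_of_real a, complex_of_real b, complex_of_real e)) ` K"
  define F0 where "F0 = F - span2 p q"
  have F0: "finite F0" "F0 \<subseteq> carrier_vec d" "F0 \<inter> span2 p q = {}" using F by (auto simp: F0_def)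
  have "finite K'" by (simp add: K'_def K_def)
  moreover have "\<gamma> \<noteq> 0" if "(\<alpha>, \<beta>, \<gamma>) \<in> K'" for \<alpha> \<beta> \<gamma>
    using that x w k c s by (auto simp: K'_def K_def)
  ultimately obtain n where n: "n \<in> carrier_vec d" "braket n n = 1" "braket p n = 0" "braket q n = 0"
    and gen: "\<And>z a b c. z \<in> F0 \<Longrightarrow> (a, b, c) \<in> K' \<Longrightarrow> braket z (a \<cdot>\<^sub>v p + b \<cdot>\<^sub>v q + c \<cdot>\<^sub>v n) \<noteq> 0"
    using generic_third[OF p q pq d F0, of K'] by metis
  have fr: "frame3 d p q n" using p q n pq by (simp add: frame3_def)
  define L where "L = lin3 p q n"
  have Lc: "L \<alpha> \<beta> \<gamma> \<in> carrier_vec d" for \<alpha> \<beta> \<gamma> using lin3_carrier[OF fr] by (simp add: L_def)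
  have LL: "braket (L \<alpha> \<beta> \<gamma>) (L \<alpha>' \<beta>' \<gamma>') = complex_of_real (\<alpha> * \<alpha>' + \<beta> * \<beta>' + \<gamma> * \<gamma>')" for \<alpha> \<beta> \<gamma> \<alpha>' \<beta>' \<gamma>'
    using lin3_braket[OF fr] by (simp add: L_def)
  have uL: "u = L c s 0" using p q n unfolding ueq L_def lin3_def by auto
  have pL: "p = L 1 0 0" using p q n unfolding L_def lin3_def by auto
  have vL: "braket v (L \<alpha> \<beta> \<gamma>) = cnj \<zeta> * complex_of_real \<alpha>" for \<alpha> \<beta> \<gamma>
    using braket_smult_left[OF Lc p(1)] LL[of 1 0 0] unfolding zt(2) pL by simp
  have Lv: "braket (L \<alpha> \<beta> \<gamma>) v = \<zeta> * complex_of_real \<alpha>" for \<alpha> \<beta> \<gamma>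
    using braket_smult_right[OF Lc p(1)] LL[of _ _ _ 1 0 0] unfolding zt(2) pL by simp
  \<comment> \<open>Members of \<open>F\<close> inside the plane are beyond the reach of
    \<open>n\<close>. By \<open>Fspan\<close> they are orthogonal to \<open>v\<close>, hence nonzero
    multiples of \<open>q\<close>, and it is enough that all triples in \<open>K\<close> have a
    nonzero second coordinate.\<close>
  have KF: "braket z (L \<alpha> \<beta> \<gamma>) \<noteq> 0" if z: "z \<in> F" and K: "(\<alpha>, \<beta>, \<gamma>) \<in> K" for z \<alpha> \<beta> \<gamma>
  proof (cases "z \<in> span2 p q")
    case False
    then have "z \<in> F0" using z by (simp add: F0_def)
    moreover have "(complex_of_real \<alpha>, complex_of_real \<beta>, complex_of_real \<gamma>) \<in> K'"
      using K by (force simp: K'_def)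
    ultimately show ?thesis using gen by (simp add: L_def lin3_def)
  next
    case True
    then obtain a b where ab: "z = a \<cdot>\<^sub>v p + b \<cdot>\<^sub>v q" by (auto simp: span2_def)
    have vz: "braket v z = 0" and uz: "braket u z \<noteq> 0" using Fspan[OF z] True sp by auto
    have qp: "braket q p = 0" using braket_cnj[OF p(1) q(1)] pq by simp
    have "braket v z = cnj \<zeta> * a"
      using p q pq unfolding zt(2) ab by (simp add: braket_simps[where d = d])
    then have "a = 0" using vz zt by simp
    then have "braket u z = complex_of_real s * b"
      using p q pq qp unfolding ueq ab by (simp add: braket_simps[where d = d])
    then have "b \<noteq> 0" using uz by auto
    have "\<beta> \<noteq> 0" using K x w k c s by (auto simp: K_def)
    have "braket z (L \<alpha> \<beta> \<gamma>) = cnj b * complex_of_real \<beta>"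
      using p q n pq qp \<open>a = 0\<close> unfolding ab L_def lin3_def by (simp add: braket_simps[where d = d])
    then show ?thesis using \<open>b \<noteq> 0\<close> \<open>\<beta> \<noteq> 0\<close> by simp
  qed
  \<comment> \<open>\<open>g\<close> is the normalized component of \<open>u\<close> orthogonal to
    \<open>a\<close>; \<open>b\<close> and \<open>h\<close> are the mirror images of
    \<open>a\<close> and \<open>g\<close> under changing the sign of \<open>n\<close>. Up to sign,
    \<open>r1\<close> and \<open>r2\<close> are the cross products of \<open>u\<close> with
    \<open>a\<close> and with \<open>b\<close>.\<close>
  define a b g h r1 r2 where "a = L 0 x w" and "b = L 0 x (- w)"
    and "g = L (k * c) (k * s * w\<^sup>2) (- (k * s * x * w))"
    and "h = L (k * c) (k * s * w\<^sup>2) (k * s * x * w)"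
    and "r1 = L (s * w) (- (c * w)) (c * x)" and "r2 = L (s * w) (- (c * w)) (- (c * x))"
  note defs = a_def b_def g_def h_def r1_def r2_def
  have "s * (x\<^sup>2 + w\<^sup>2) = s" using xw by simp
  then have sxw: "s = s * w\<^sup>2 + s * x * x" by (simp add: algebra_simps power2_eq_square)
  have u_span: "u \<in> span2 g a" "u \<in> span2 h b"
    unfolding uL defs L_def
    by (rule lin3_span2[OF fr, where l = "1 / k" and m = "s * x"];
        use k sxw in \<open>simp add: power2_eq_square\<close>)+
  have nzF: "braket z k \<noteq> 0" if "z \<in> F" "k \<in> {a, b, g, h, r1, r2}" for z k
    using that KF unfolding defs K_def by blast
  \<comment> \<open>In this identity and in the next, the correction terms carry the factors
    \<open>c^2 + s^2 - 1\<close> and \<open>x^2 + w^2 - 1\<close>. They are thus plain polynomial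
    identities, to which the constraints are applied afterwards.\<close>
  have unit_gh: "(k * c)\<^sup>2 + (k * s * w\<^sup>2)\<^sup>2 + (k * s * x * w)\<^sup>2 = 1"
  proof -
    have "(k * c)\<^sup>2 + (k * s * w\<^sup>2)\<^sup>2 + (k * s * x * w)\<^sup>2 = k\<^sup>2 * (1 - s\<^sup>2 * x\<^sup>2)
      + k\<^sup>2 * ((c\<^sup>2 + s\<^sup>2 - 1) + s\<^sup>2 * (1 + w\<^sup>2) * (x\<^sup>2 + w\<^sup>2 - 1))"
      by (simp add: algebra_simps power2_eq_square)
    then show ?thesis unfolding ks s(2) xw by simp
  qed
  have gh: "(k * c)\<^sup>2 + (k * s * w\<^sup>2)\<^sup>2 - (k * s * x * w)\<^sup>2 = 0"
  proof -
    have "(k * c)\<^sup>2 + (k * s * w\<^sup>2)\<^sup>2 - (k * s * x * w)\<^sup>2 = k\<^sup>2 * ((1 - s\<^sup>2 * x\<^sup>2 * (3 - 2 * x\<^sup>2))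
      + (c\<^sup>2 + s\<^sup>2 - 1) + s\<^sup>2 * (x\<^sup>2 + w\<^sup>2 - 1) * (2 - 3 * x\<^sup>2 + (x\<^sup>2 + w\<^sup>2 - 1)))"
      by (simp add: algebra_simps power2_eq_square)
    then show ?thesis unfolding clifton s(2) xw by simp
  qed
  have gu: "k * c * c + k * s * w\<^sup>2 * s \<noteq> 0"
  proof -
    have "k * c * c + k * s * w\<^sup>2 * s > 0" using k c s w by (intro add_pos_pos) simp_all
    then show ?thesis by simp
  qed
  have bg: "x * (k * s * w\<^sup>2) + w * (k * s * x * w) \<noteq> 0"
  proof -
    have "x * (k * s * w\<^sup>2) + w * (k * s * x * w) > 0" using k x s w by (intro add_pos_pos) simp_all
    then show ?thesis by simp
  qed
  have r1h: "s * w * (k * c) + - (c * w) * (k * s * w\<^sup>2) + c * x * (k * s * x * w) \<noteq> 0"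
  proof -
    have "s * w * (k * c) + - (c * w) * (k * s * w\<^sup>2) + c * x * (k * s * x * w)
        = 2 * (c * k * s * w * x\<^sup>2) + c * k * s * w * (1 - (x\<^sup>2 + w\<^sup>2))"
      by (simp add: algebra_simps power2_eq_square)
    then show ?thesis unfolding xw using c k s w x by simp
  qed
  have r12: "(s * w)\<^sup>2 + (c * w)\<^sup>2 - (c * x)\<^sup>2 \<noteq> 0"
  proof -
    have "(s * w)\<^sup>2 + (c * w)\<^sup>2 - (c * x)\<^sup>2 = w\<^sup>2 * (c\<^sup>2 + s\<^sup>2) - c\<^sup>2 * x\<^sup>2"
      by (simp add: algebra_simps power2_eq_square)
    then show ?thesis unfolding s(2) using neq by simp
  qed
  obtain X where X: "finite X" "vector_set d (S \<union> X)"
    "\<And>x z. x \<in> X \<Longrightarrow> z \<in> F \<Longrightarrow> braket z x \<noteq> 0"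
    "\<And>A. col d (S \<union> X) A \<Longrightarrow> \<not> (u \<in> A \<and> v \<in> A)"
    "\<And>A. col d S A \<Longrightarrow> \<not> (u \<in> A \<and> v \<in> A) \<Longrightarrow> \<exists>A'. col d (S \<union> X) A' \<and> A' \<inter> S = A"
  proof (rule pentagon_gadget[of d S u v F a b g h r1 r2])
    show "braket a a = 1" "braket b b = 1"
      using xw unfolding defs LL by (simp_all add: power2_eq_square del: of_real_add of_real_mult)
    show "braket g g = 1" "braket h h = 1"
      using unit_gh unfolding defs LL by (simp_all add: power2_eq_square del: of_real_add of_real_mult)
    show "braket g h = 0"
      using gh unfolding defs LL by (simp add: power2_eq_square del: of_real_add of_real_mult)
    have "s * w * (k * c) + - (c * w) * (k * s * w\<^sup>2) - c * x * (k * s * x * w)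
        = c * k * s * w * (1 - (x\<^sup>2 + w\<^sup>2))"
      by (simp add: algebra_simps power2_eq_square)
    then show "braket r1 g = 0" "braket r2 h = 0"
      unfolding xw defs LL of_real_eq_0_iff by simp_all
    show "braket g a = 0" "braket h b = 0" "braket r1 a = 0" "braket r2 b = 0"
      unfolding defs LL of_real_eq_0_iff by (simp_all add: power2_eq_square)
    show "braket v a = 0" "braket v b = 0" unfolding defs vL by simp_all
    show "braket v g \<noteq> 0" "braket v h \<noteq> 0" "braket r1 v \<noteq> 0" "braket r2 v \<noteq> 0"
      unfolding defs vL Lv using zt(1) k c s w by simp_all
    show "braket g u \<noteq> 0" "braket h u \<noteq> 0" "braket a u \<noteq> 0" "braket b u \<noteq> 0"
      unfolding defs uL LL of_real_eq_0_iff using gu x s by (simp_all add: mult_ac)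
    show "braket a b \<noteq> 0"
      unfolding defs LL of_real_eq_0_iff using neq by (simp add: power2_eq_square)
    show "braket a h \<noteq> 0" "braket b g \<noteq> 0"
      unfolding defs LL of_real_eq_0_iff using bg by (simp_all add: mult_ac)
    show "braket r1 h \<noteq> 0" "braket r2 g \<noteq> 0"
      unfolding defs LL of_real_eq_0_iff using r1h by (simp_all add: mult_ac)
    show "braket r1 r2 \<noteq> 0"
      unfolding defs LL of_real_eq_0_iff using r12 by (simp add: power2_eq_square)
    show "braket r1 b \<noteq> 0" "braket r2 a \<noteq> 0" "braket a r2 \<noteq> 0"
      unfolding defs LL of_real_eq_0_iff using c w x by (simp_all add: mult_ac)
    show "u \<in> span2 g a" "u \<in> span2 h b" by (rule u_span)+
    show "a \<in> carrier_vec d" "b \<in> carrier_vec d" "g \<in> carrier_vec d" "h \<in> carrier_vec d"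
      "r1 \<in> carrier_vec d" "r2 \<in> carrier_vec d" unfolding defs by (rule Lc)+
  qed (use d S uv F nzF in auto)
  show ?thesis by (rule that[OF X])
qed

section \<open>Chaining two exclusions\<close>

text \<open>Iterates Clifton's gadget: with a basis containing \<open>w\<close> and \<open>w'\<close> whose plane contains \<open>u\<close>,
  excluding \<open>u, w'\<close> makes \<open>u\<close> imply \<open>w\<close>, and then excluding \<open>w, v\<close> excludes \<open>u, v\<close>.
  The vectors \<open>\<rho>\<close> and \<open>r\<close> certify that other vectors lie outside the planes of \<open>w, w'\<close> and of \<open>w, v\<close>.\<close>

lemma chain_gadget:
  assumes d: "d \<ge> 3" and S: "vector_set d S" and uv: "u \<in> S" "v \<in> S"
    and F: "finite F" "F \<subseteq> carrier_vec d" "S - {u, v} \<subseteq> F"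
    and car: "w \<in> carrier_vec d" "w' \<in> carrier_vec d" "\<rho> \<in> carrier_vec d" "r \<in> carrier_vec d"
    and unit: "braket w w = 1" "braket w' w' = 1"
    and zero: "braket w w' = 0" "braket \<rho> u = 0" "braket \<rho> w = 0" "braket \<rho> w' = 0"
      "braket r w = 0" "braket r v = 0"
    and span: "u \<in> span2 w w'"
    and nzF: "\<And>z k. z \<in> F \<Longrightarrow> k \<in> {w, w', \<rho>, r} \<Longrightarrow> braket z k \<noteq> 0"
    and nz: "braket w u \<noteq> 0" "braket w' u \<noteq> 0" "braket w v \<noteq> 0" "braket w' v \<noteq> 0"
      "braket \<rho> v \<noteq> 0" "braket \<rho> r \<noteq> 0" "braket r u \<noteq> 0" "braket r w' \<noteq> 0"
    and small: "(cmod (braket w' u))\<^sup>2 < 1 / 9" "(cmod (braket v w))\<^sup>2 < 1 / 9"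
  obtains X where "finite X" "vector_set d (S \<union> X)"
    "\<And>x z. x \<in> X \<Longrightarrow> z \<in> F \<Longrightarrow> braket z x \<noteq> 0"
    "\<And>A. col d (S \<union> X) A \<Longrightarrow> \<not> (u \<in> A \<and> v \<in> A)"
    "\<And>A. col d S A \<Longrightarrow> \<not> (u \<in> A \<and> v \<in> A) \<Longrightarrow> \<exists>A'. col d (S \<union> X) A' \<and> A' \<inter> S = A"
proof -
  have Sc: "z \<in> carrier_vec d" "braket z z = 1" if "z \<in> S" for z
    using S that by (auto simp: vector_set_def)
  note u = Sc[OF uv(1)] and v = Sc[OF uv(2)]
  note sym = braket_eq_0_commute[where d = d]
  have zero': "braket w' w = 0" using zero(1) sym car by blast
  have nz': "braket u w \<noteq> 0" "braket u w' \<noteq> 0" "braket v w \<noteq> 0" "braket v w' \<noteq> 0" "braket w' r \<noteq> 0"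
    using nz sym car u v by blast+
  have nzF': "braket k z \<noteq> 0" if "z \<in> F" "k \<in> {w, w', \<rho>, r}" for z k
  proof -
    have "k \<in> carrier_vec d" "z \<in> carrier_vec d" using that car F by auto
    then show ?thesis using nzF[OF that] sym by blast
  qed
  have Sw: "braket k z \<noteq> 0 \<and> braket z k \<noteq> 0" if zk: "z \<in> S" "k \<in> {w, w'}" for z k
  proof -
    consider "z \<in> F" | "z = u" | "z = v" using F(3) zk by auto
    then show ?thesis
      using zk nz nz' nzF[of z k] nzF'[of z k] by cases auto
  qed
  define X0 where "X0 = {w, w'}"
  define S1 where "S1 = S \<union> X0"
  have "vector_set d X0"
  proof (rule vector_setI)
    fix x y assume "x \<in> X0" "y \<in> X0" "x \<noteq> y"
    then show "\<exists>r\<in>carrier_vec d. (braket r x = 0) \<noteq> (braket r y = 0)"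
      using car(1) zero(1) unit(1) by (intro bexI[of _ w]) (auto simp: X0_def)
  qed (use car unit in \<open>auto simp: X0_def\<close>)
  moreover have "\<exists>r\<in>carrier_vec d. (braket r x = 0) \<noteq> (braket r z = 0)" if x: "x \<in> X0" and z: "z \<in> S" for x z
  proof (cases "x = w")
    case True
    then show ?thesis using Sw[OF z, of w'] zero' car by auto
  next
    case False
    then show ?thesis using Sw[OF z, of w] zero car x by (auto simp: X0_def)
  qed
  ultimately have S1: "vector_set d S1" "S \<inter> X0 = {}"
    using vector_set_Un[OF S] by (auto simp: S1_def)
  have mem1: "w \<in> S1" "w' \<in> S1" "u \<in> S1" "v \<in> S1" using uv by (auto simp: S1_def X0_def)
  have new: "w \<notin> S" "w' \<notin> S" using S1(2) by (auto simp: X0_def)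
  \<comment> \<open>\<open>r\<close> is carried along here and in \<open>F2\<close>: it certifies at
    the last stage that the vectors added in between lie outside the plane of
    \<open>w, v\<close>.\<close>
  define F1 where "F1 = F \<union> {v, r}"
  have F1: "finite F1" "F1 \<subseteq> carrier_vec d" "S1 - {u, w, w'} \<subseteq> F1"
    using F car v by (auto simp: F1_def S1_def X0_def)
  have F1s: "F1 \<inter> span2 w w' = {}"
    by (rule not_in_span2[OF car(1) car(2) car(3)]) (use zero nz nzF' in \<open>auto simp: F1_def\<close>)
  have F1p: "braket w z \<noteq> 0 \<or> braket w' z \<noteq> 0" if "z \<in> F1" for z
    using that nz nz' nzF'[of z w] by (auto simp: F1_def)
  obtain X1 where X1: "finite X1" "vector_set d (S1 \<union> X1)"
    "\<And>x z. x \<in> X1 \<Longrightarrow> z \<in> F1 \<Longrightarrow> braket z x \<noteq> 0"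
    "\<And>x. x \<in> X1 \<Longrightarrow> braket w x = 0 \<and> braket w' x = 0"
    "\<And>A. col d (S1 \<union> X1) A \<Longrightarrow> u \<in> A \<Longrightarrow> w \<in> A \<or> w' \<in> A"
    "\<And>A. col d S1 A \<Longrightarrow> (u \<in> A \<longrightarrow> w \<in> A \<or> w' \<in> A) \<Longrightarrow> \<exists>A'. col d (S1 \<union> X1) A' \<and> A' \<inter> S1 = A"
    by (rule complete_plane[OF d S1(1) mem1(1,2,3) zero(1) span nz(1,2) F1(1,2) F1s F1(3)], erule F1p, rule that; blast)
  define S2 where "S2 = S1 \<union> X1"
  have S2: "vector_set d S2" using X1(2) by (simp add: S2_def)
  have X1c: "x \<in> carrier_vec d" "braket x x = 1" if "x \<in> X1" for x
    using X1(2) that by (auto simp: vector_set_def)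
  have mem2: "u \<in> S2" "w' \<in> S2" "w \<in> S2" using mem1 by (auto simp: S2_def)
  define F2 where "F2 = F \<union> {v, w, r} \<union> X1"
  have F2: "finite F2" "F2 \<subseteq> carrier_vec d" "S2 - {u, w'} \<subseteq> F2"
    using F car v X1(1) X1c by (auto simp: F2_def S2_def S1_def X0_def)
  \<comment> \<open>As \<open>u\<close> lies in the plane of \<open>w, w'\<close>, conversely
    \<open>w\<close> lies in that of \<open>u, w'\<close>. It is orthogonal to \<open>w'\<close> but
    not to \<open>u\<close>, exactly the exception that \<open>exclude_small\<close> admits. Vectors
    in \<open>X1\<close> are unit vectors orthogonal to this whole plane; \<open>\<rho>\<close>
    deals with the others.\<close>
  have F2s: "braket w' z = 0 \<and> braket u z \<noteq> 0" if z: "z \<in> F2" "z \<in> span2 u w'" for z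
  proof -
    have "braket \<rho> z = 0" using span2_orth[OF u(1) car(2) car(3) zero(2,4) z(2)] .
    then have "z \<notin> F \<union> {v, r}" using nz nzF'[of z \<rho>] by auto
    moreover have "z \<notin> X1"
    proof
      assume x: "z \<in> X1"
      have "braket z w = 0" "braket z w' = 0" using X1(4)[OF x] sym X1c(1)[OF x] car by blast+
      moreover from this have "braket z u = 0" using span2_orth[OF car(1,2) X1c(1)[OF x]] span by blast
      ultimately have "braket z z = 0" using span2_orth[OF u(1) car(2) X1c(1)[OF x]] z(2) by blast
      then show False using X1c[OF x] by simp
    qed
    ultimately have "z = w" using z(1) by (auto simp: F2_def)
    then show ?thesis using zero' nz' by simp
  qed
  obtain X2 where X2: "finite X2" "vector_set d (S2 \<union> X2)"
    "\<And>x z. x \<in> X2 \<Longrightarrow> z \<in> F2 \<Longrightarrow> braket z x \<noteq> 0"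
    "\<And>A. col d (S2 \<union> X2) A \<Longrightarrow> \<not> (u \<in> A \<and> w' \<in> A)"
    "\<And>A. col d S2 A \<Longrightarrow> \<not> (u \<in> A \<and> w' \<in> A) \<Longrightarrow> \<exists>A'. col d (S2 \<union> X2) A' \<and> A' \<inter> S2 = A"
    by (rule exclude_small[OF d S2 mem2(1,2) nz(2) small(1) F2], erule (1) F2s, rule that; blast)
  define S3 where "S3 = S2 \<union> X2"
  have S3: "vector_set d S3" using X2(2) by (simp add: S3_def)
  have mem3: "w \<in> S3" "v \<in> S3" using mem1 by (auto simp: S2_def S3_def)
  define F3 where "F3 = F \<union> {u, w'} \<union> X1 \<union> X2"
  have X2c: "x \<in> carrier_vec d" if "x \<in> X2" for x
    using X2(2) that by (auto simp: vector_set_def)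
  have F3: "finite F3" "F3 \<subseteq> carrier_vec d" "S3 - {w, v} \<subseteq> F3"
    using F car u X1(1) X1c X2(1) X2c by (auto simp: F3_def S3_def S2_def S1_def X0_def)
  have "F3 \<inter> span2 w v = {}"
    by (rule not_in_span2[OF car(1) v(1) car(4)])
      (use zero nz nzF' X1(3)[of _ r] X2(3)[of _ r] in \<open>auto simp: F1_def F2_def F3_def\<close>)
  then have F3s: "braket v z = 0 \<and> braket w z \<noteq> 0" if "z \<in> F3" "z \<in> span2 w v" for z
    using that by blast
  obtain X3 where X3: "finite X3" "vector_set d (S3 \<union> X3)"
    "\<And>x z. x \<in> X3 \<Longrightarrow> z \<in> F3 \<Longrightarrow> braket z x \<noteq> 0"
    "\<And>A. col d (S3 \<union> X3) A \<Longrightarrow> \<not> (w \<in> A \<and> v \<in> A)"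
    "\<And>A. col d S3 A \<Longrightarrow> \<not> (w \<in> A \<and> v \<in> A) \<Longrightarrow> \<exists>A'. col d (S3 \<union> X3) A' \<and> A' \<inter> S3 = A"
    by (rule exclude_small[OF d S3 mem3 nz'(3) small(2) F3], erule (1) F3s, rule that; blast)
  define X where "X = X0 \<union> X1 \<union> X2 \<union> X3"
  have SX: "S \<union> X = S3 \<union> X3" by (auto simp: X_def S3_def S2_def S1_def)
  show ?thesis
  proof
    show "finite X" using X1(1) X2(1) X3(1) by (simp add: X_def X0_def)
    show "vector_set d (S \<union> X)" using X3(2) SX by simp
    show "braket z x \<noteq> 0" if "x \<in> X" "z \<in> F" for x z
      using that nzF X1(3)[of x z] X2(3)[of x z] X3(3)[of x z]
      by (auto simp: X_def X0_def F1_def F2_def F3_def)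
  next
    fix A assume "col d (S \<union> X) A"
    then have A: "col d (S3 \<union> X3) A" using SX by simp
    have A3: "col d (S2 \<union> X2) (A \<inter> S3)" using col_restrict[OF A, of S3] by (simp add: S3_def)
    have A2: "col d (S1 \<union> X1) (A \<inter> S3 \<inter> S2)" using col_restrict[OF A3, of S2] by (simp add: S2_def)
    show "\<not> (u \<in> A \<and> v \<in> A)"
      using X3(4)[OF A] X2(4)[OF A3] X1(5)[OF A2] mem2 by (auto simp: S3_def)
  next
    fix A assume A: "col d S A" and nuv: "\<not> (u \<in> A \<and> v \<in> A)"
    have AS: "A \<subseteq> S" using A by (simp add: col_def)
    \<comment> \<open>\<open>w\<close> takes over the value 1 demanded by \<open>u\<close>, and
      \<open>w'\<close> gets 0. Both exclusions still to be added are then respected, as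
      \<open>v\<close> has value 0 whenever \<open>w\<close> has value 1.\<close>
    define A1 where "A1 = (if u \<in> A then insert w A else A)"
    have "\<not> orthogonal_vecs x y" if xy: "x \<in> A1" "y \<in> A1" "x \<noteq> y" for x y
    proof -
      have "\<not> orthogonal_vecs z w \<and> \<not> orthogonal_vecs w z" if "z \<in> A" for z
        using Sw[of z w] that AS by (auto simp: orthogonal_vecs_def)
      then show ?thesis using xy A unfolding A1_def col_def by (auto split: if_splits)
    qed
    moreover have "C \<inter> A1 \<noteq> {}" if C: "is_clique S1 orthogonal_vecs C" "card C = d" for C
    proof (cases "C \<subseteq> S")
      case True
      then have "is_clique S orthogonal_vecs C" using C by (auto simp: is_clique_def)
      then show ?thesis using A C unfolding col_def A1_def by auto
    next
      case False
      obtain k where k: "k \<in> C" "k \<in> X0" using False C by (auto simp: is_clique_def S1_def)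
      have "z \<notin> S" if "z \<in> C" for z
      proof
        assume z: "z \<in> S"
        then have "z \<noteq> k" using k S1(2) by auto
        then have "braket z k = 0"
          using C(1) k that by (simp add: is_clique_def orthogonal_vecs_def)
        then show False using Sw[OF z] k by (auto simp: X0_def)
      qed
      then have "C \<subseteq> {w, w'}" using C by (auto simp: is_clique_def S1_def X0_def)
      then have "card C \<le> card {w, w'}" by (intro card_mono) simp_all
      also have "\<dots> \<le> 2" by (simp add: card_insert_if)
      finally show ?thesis using C(2) d by simp
    qed
    moreover have "A1 \<subseteq> S1" "A1 \<inter> S = A"
      using AS new by (auto simp: A1_def S1_def X0_def)
    ultimately have "col d S1 A1" by (auto simp: col_def)
    moreover have "u \<in> A1 \<longrightarrow> w \<in> A1 \<or> w' \<in> A1" using new uv by (auto simp: A1_def)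
    ultimately obtain A2 where A2: "col d S2 A2" "A2 \<inter> S1 = A1" using X1(6) S2_def by blast
    have "w' \<notin> A1" using new zero unit AS by (auto simp: A1_def)
    then have "\<not> (u \<in> A2 \<and> w' \<in> A2)" using A2 mem1 by auto
    then obtain A3 where A3: "col d S3 A3" "A3 \<inter> S2 = A2" using X2(5) A2(1) S3_def by blast
    have "\<not> (w \<in> A1 \<and> v \<in> A1)" using nuv new AS uv by (auto simp: A1_def split: if_splits)
    then have "\<not> (w \<in> A3 \<and> v \<in> A3)" using A2 A3 mem1 S2_def by auto
    then obtain A4 where A4: "col d (S3 \<union> X3) A4" "A4 \<inter> S3 = A3" using X3(5) A3(1) by blast
    have "S \<subseteq> S1" "S1 \<subseteq> S2" "S2 \<subseteq> S3" by (auto simp: S1_def S2_def S3_def)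
    then have "A4 \<inter> S = A" using A4(2) A3(2) A2(2) \<open>A1 \<inter> S = A\<close> by blast
    then show "\<exists>A'. col d (S \<union> X) A' \<and> A' \<inter> S = A" using A4(1) SX by auto
  qed
qed

text \<open>\<open>m * (k c, s, e)\<close> are the coordinates of the unit vector \<open>w\<close>:
  in \<open>u = (c, s, 0)\<close> the component along \<open>v\<close> is shrunk by
  \<open>k\<close>, and a tilt \<open>e\<close> leads out of the plane. \<open>A\<close> is the
  overlap of \<open>u\<close> with \<open>w\<close>, and \<open>B\<close> that with the vector
  \<open>w'\<close> orthogonal to \<open>w\<close> in the plane of \<open>u, w\<close>. Shrinking
  has to be strong enough to bring \<open>m k c\<close> below 1/3 and weak enough to keep
  \<open>B\<close> below 1/3. The last inequality keeps \<open>w'\<close> from being orthogonal to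
  \<open>v\<close>.\<close>

lemma chain_parameters:
  fixes c s :: real
  assumes c: "c > 0" and s: "s > 0" and cs: "c\<^sup>2 + s\<^sup>2 = 1" and small: "c\<^sup>2 \<le> 9 / 25"
  obtains k e m A B where "0 < k" "k < 1" "e > 0" "m > 0" "A > 0" "B > 0"
    "m\<^sup>2 * ((k * c)\<^sup>2 + s\<^sup>2 + e\<^sup>2) = 1" "A = m * (k * c\<^sup>2 + s\<^sup>2)" "A\<^sup>2 + B\<^sup>2 = 1"
    "B\<^sup>2 < 1 / 9" "(m * k * c)\<^sup>2 < 1 / 9" "A * m * k < 1"
proof -
  define k e :: real where "k = 9 / 20" and "e = 1 / 15"
  define N where "N = (k * c)\<^sup>2 + s\<^sup>2 + e\<^sup>2"
  \<comment> \<open>By Lagrange's identity and \<open>c^2 + s^2 = 1\<close>, this is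
    \<open>N - (k * c^2 + s^2)^2\<close>, so \<open>Q / N\<close> becomes the square of
    \<open>B\<close>.\<close>
  define Q where "Q = c\<^sup>2 * s\<^sup>2 * (1 - k)\<^sup>2 + e\<^sup>2"
  have k: "0 < k" "k < 1" and e: "e > 0" by (simp_all add: k_def e_def)
  have N: "N > 0" and Q: "Q > 0" using e by (auto simp: N_def Q_def intro!: add_nonneg_pos)
  define C where "C = c\<^sup>2"
  have C: "0 < C" "C \<le> 9 / 25" and s2: "s\<^sup>2 = 1 - C" using c small cs by (auto simp: C_def)
  have NC: "N = 226 / 225 - 319 / 400 * C"
    unfolding N_def power_mult_distrib s2 C_def[symmetric] by (simp add: k_def e_def power2_eq_square)
  have QC: "Q = C * (1 - C) * (121 / 400) + 1 / 225"
    unfolding Q_def s2 C_def[symmetric] by (simp add: k_def e_def power2_eq_square)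
  \<comment> \<open>\<open>N - 9 * Q\<close> is a quadratic polynomial in \<open>C\<close>,
    decreasing on the admissible range. The product is its excess over its value at 9/25, which is
    positive.\<close>
  have "0 \<le> (9 / 25 - C) * (88 / 25 - 1089 / 400 * (C + 9 / 25))"
    using C by (intro mult_nonneg_nonneg) auto
  moreover have "(9 / 25 - C) * (88 / 25 - 1089 / 400 * (C + 9 / 25))
      = 228591 / 250000 - 88 / 25 * C + 1089 / 400 * (C * C)"
    by (simp add: field_simps)
  ultimately have "0 \<le> 228591 / 250000 - 88 / 25 * C + 1089 / 400 * (C * C)" by (simp only:)
  moreover have "Q = 121 / 400 * C - 121 / 400 * (C * C) + 1 / 225"
    unfolding QC by (simp add: field_simps)
  ultimately have NQ: "9 * Q < N" using NC by linarith
  have "(k * c)\<^sup>2 = 81 / 400 * C"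
    unfolding power_mult_distrib C_def[symmetric] by (simp add: k_def power2_eq_square)
  then have kN: "9 * (k * c)\<^sup>2 < N" using C unfolding NC by simp
  define m where "m = 1 / sqrt N"
  have m: "m > 0" "m\<^sup>2 * N = 1" "m\<^sup>2 = 1 / N" using N by (auto simp: m_def power_divide)
  define A where "A = m * (k * c\<^sup>2 + s\<^sup>2)"
  define B where "B = m * sqrt Q"
  have A: "A > 0" using m k s by (simp add: A_def add_nonneg_pos)
  have B: "B > 0" "B\<^sup>2 = m\<^sup>2 * Q" using m Q by (auto simp: B_def power_mult_distrib)
  have "(k * c\<^sup>2 + s\<^sup>2)\<^sup>2 + Q = N"
    unfolding Q_def N_def power_mult_distrib s2 C_def[symmetric]
    by (simp add: algebra_simps power2_eq_square)
  then have "m\<^sup>2 * ((k * c\<^sup>2 + s\<^sup>2)\<^sup>2 + Q) = 1" using m by simp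
  moreover have "A\<^sup>2 = m\<^sup>2 * (k * c\<^sup>2 + s\<^sup>2)\<^sup>2" by (simp add: A_def power_mult_distrib)
  ultimately have AB: "A\<^sup>2 + B\<^sup>2 = 1" unfolding B(2) by (simp add: distrib_left)
  have B9: "B\<^sup>2 < 1 / 9" using NQ N unfolding B(2) m(3) by (simp add: field_simps)
  have mk: "(m * k * c)\<^sup>2 < 1 / 9"
  proof -
    have "(m * k * c)\<^sup>2 = m\<^sup>2 * (k * c)\<^sup>2" by (simp add: power_mult_distrib)
    also have "\<dots> = (k * c)\<^sup>2 / N" unfolding m(3) by simp
    also have "\<dots> < 1 / 9" using kN N by (simp add: pos_divide_less_eq)
    finally show ?thesis .
  qed
  have "A * m * k = (m\<^sup>2 * k) * (k * c\<^sup>2 + s\<^sup>2)" by (simp add: A_def power2_eq_square)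
  also have "\<dots> < m\<^sup>2 * N"
  proof -
    have "N - k * (k * c\<^sup>2 + s\<^sup>2) = (s\<^sup>2 - k * s\<^sup>2) + e\<^sup>2"
      by (simp add: N_def algebra_simps power2_eq_square)
    moreover have "k * s\<^sup>2 < s\<^sup>2" "e\<^sup>2 > 0" using k s e by simp_all
    ultimately have "k * (k * c\<^sup>2 + s\<^sup>2) < N" by linarith
    then show ?thesis using m(1) by simp
  qed
  finally have "A * m * k < 1" using m by simp
  then show ?thesis
    by (intro that[OF k e m(1) A B(1) _ A_def AB B9 mk]) (use m N_def in simp_all)
qed

lemma exclude_pair:
  assumes d: "d \<ge> 3" and S: "vector_set d S" and uv: "u \<in> S" "v \<in> S"
    and ov: "braket v u \<noteq> 0" "(cmod (braket v u))\<^sup>2 \<le> 9 / 25"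
    and F: "finite F" "F \<subseteq> carrier_vec d" "S - {u, v} \<subseteq> F" "F \<inter> span2 u v = {}"
  obtains X where "finite X" "vector_set d (S \<union> X)"
    "\<And>x z. x \<in> X \<Longrightarrow> z \<in> F \<Longrightarrow> braket z x \<noteq> 0"
    "\<And>A. col d (S \<union> X) A \<Longrightarrow> \<not> (u \<in> A \<and> v \<in> A)"
    "\<And>A. col d S A \<Longrightarrow> \<not> (u \<in> A \<and> v \<in> A) \<Longrightarrow> \<exists>A'. col d (S \<union> X) A' \<and> A' \<inter> S = A"
proof -
  have u: "u \<in> carrier_vec d" "braket u u = 1" and v: "v \<in> carrier_vec d" "braket v v = 1"
    using S uv by (auto simp: vector_set_def)
  define c where "c = cmod (braket v u)"
  have "(cmod (braket v u))\<^sup>2 < 1\<^sup>2" using ov(2) by simp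
  then have ov1: "cmod (braket v u) < 1" using power_less_imp_less_base[of _ 2 "1::real"] by simp
  obtain \<zeta> p q s where zt: "\<zeta> \<noteq> 0" "v = \<zeta> \<cdot>\<^sub>v p" and p: "p \<in> carrier_vec d" "braket p p = 1"
    and q: "q \<in> carrier_vec d" "braket q q = 1" and pq: "braket p q = 0"
    and s: "s > 0" "c\<^sup>2 + s\<^sup>2 = 1"
    and ueq: "u = complex_of_real c \<cdot>\<^sub>v p + complex_of_real s \<cdot>\<^sub>v q"
    and sp: "span2 p q \<subseteq> span2 u v"
    using decompose_pair[OF u v ov(1) ov1] unfolding c_def[symmetric] by metis
  have c: "c > 0" "c\<^sup>2 \<le> 9 / 25" using ov by (auto simp: c_def)
  have "\<zeta> * cnj \<zeta> = 1"
    using v p unfolding zt(2) by (simp add: braket_simps[where d = d] mult.commute)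
  then have "complex_of_real ((cmod \<zeta>)\<^sup>2) = 1" by (simp only: complex_norm_square)
  then have cz: "(cmod \<zeta>)\<^sup>2 = 1" by (simp only: of_real_eq_1_iff)
  obtain k e m A B where par: "0 < k" "k < 1" "e > 0" "m > 0" "A > 0" "B > 0"
    and norm: "m\<^sup>2 * ((k * c)\<^sup>2 + s\<^sup>2 + e\<^sup>2) = 1" and A: "m * (k * c\<^sup>2 + s\<^sup>2) = A" and AB: "A\<^sup>2 + B\<^sup>2 = 1"
    and small: "B\<^sup>2 < 1 / 9" "(m * k * c)\<^sup>2 < 1 / 9" "A * m * k < 1"
    using chain_parameters[OF c(1) s c(2)] by metis
  define b where "b = 1 / B"
  have b: "b > 0" "b * B = 1" using par by (auto simp: b_def)
  define K where "K = {(m * k * c, m * s, m * e),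
    (b * (c - A * m * k * c), b * (s - A * m * s), - (b * A * m * e)),
    (s * e, - (c * e), c * s * (1 - k)), (0, e, - s)}"
  define K' where "K' = (\<lambda>(a, b, e). (complex_of_real a, complex_of_real b, complex_of_real e)) ` K"
  have F0: "F \<inter> span2 p q = {}" using F(4) sp by auto
  have "finite K'" by (simp add: K'_def K_def)
  moreover have "\<gamma> \<noteq> 0" if "(\<alpha>, \<beta>, \<gamma>) \<in> K'" for \<alpha> \<beta> \<gamma>
    using that par b c s by (auto simp: K'_def K_def)
  ultimately obtain n where n: "n \<in> carrier_vec d" "braket n n = 1" "braket p n = 0" "braket q n = 0"
    and gen: "\<And>z a b c. z \<in> F \<Longrightarrow> (a, b, c) \<in> K' \<Longrightarrow> braket z (a \<cdot>\<^sub>v p + b \<cdot>\<^sub>v q + c \<cdot>\<^sub>v n) \<noteq> 0"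
    using generic_third[OF p q pq d F(1,2) F0, of K'] by metis
  have fr: "frame3 d p q n" using p q n pq by (simp add: frame3_def)
  define L where "L = lin3 p q n"
  have Lc: "L \<alpha> \<beta> \<gamma> \<in> carrier_vec d" for \<alpha> \<beta> \<gamma> using lin3_carrier[OF fr] by (simp add: L_def)
  have LL: "braket (L \<alpha> \<beta> \<gamma>) (L \<alpha>' \<beta>' \<gamma>') = complex_of_real (\<alpha> * \<alpha>' + \<beta> * \<beta>' + \<gamma> * \<gamma>')" for \<alpha> \<beta> \<gamma> \<alpha>' \<beta>' \<gamma>'
    using lin3_braket[OF fr] by (simp add: L_def)
  have uL: "u = L c s 0" using p q n unfolding ueq L_def lin3_def by auto
  have pL: "p = L 1 0 0" using p q n unfolding L_def lin3_def by auto
  have vL: "braket v (L \<alpha> \<beta> \<gamma>) = cnj \<zeta> * complex_of_real \<alpha>" for \<alpha> \<beta> \<gamma>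
    using braket_smult_left[OF Lc p(1)] LL[of 1 0 0] unfolding zt(2) pL by simp
  have Lv: "braket (L \<alpha> \<beta> \<gamma>) v = \<zeta> * complex_of_real \<alpha>" for \<alpha> \<beta> \<gamma>
    using braket_smult_right[OF Lc p(1)] LL[of _ _ _ 1 0 0] unfolding zt(2) pL by simp
  have KF: "braket z (L \<alpha> \<beta> \<gamma>) \<noteq> 0" if z: "z \<in> F" and K: "(\<alpha>, \<beta>, \<gamma>) \<in> K" for z \<alpha> \<beta> \<gamma>
  proof -
    have "(complex_of_real \<alpha>, complex_of_real \<beta>, complex_of_real \<gamma>) \<in> K'"
      using K by (force simp: K'_def)
    then show ?thesis using gen[OF z] by (simp add: L_def lin3_def)
  qed
  \<comment> \<open>\<open>w'\<close> is \<open>(u - A w) / B\<close>. In the frame,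
    \<open>\<rho>\<close> is the cross product of \<open>u\<close> with \<open>w\<close> before
    normalization, hence normal to the plane of \<open>w, w'\<close>; \<open>r\<close> is normal to
    \<open>w\<close> and to the first axis, the direction of \<open>v\<close>.\<close>
  define w w' \<rho> r where "w = L (m * k * c) (m * s) (m * e)"
    and "w' = L (b * (c - A * m * k * c)) (b * (s - A * m * s)) (- (b * A * m * e))"
    and "\<rho> = L (s * e) (- (c * e)) (c * s * (1 - k))" and "r = L 0 e (- s)"
  note defs = w_def w'_def \<rho>_def r_def
  have Bb: "B * (b * t) = t" for t using b(2) by (simp add: mult.assoc[symmetric] mult.commute)
  have u_span: "u \<in> span2 w w'"
    unfolding uL defs L_def
    by (rule lin3_span2[OF fr, where l = A and m = B])
      (simp_all add: mult.assoc Bb)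
  have nzF: "braket z k \<noteq> 0" if "z \<in> F" "k \<in> {w, w', \<rho>, r}" for z k
    using that KF unfolding defs K_def by blast
  have uw: "m * k * c * c + m * s * s + m * e * 0 = A"
    using A by (simp add: algebra_simps power2_eq_square)
  have ww': "m * k * c * (b * (c - A * m * k * c)) + m * s * (b * (s - A * m * s))
      + m * e * (- (b * A * m * e)) = 0"
  proof -
    have "m * k * c * (b * (c - A * m * k * c)) + m * s * (b * (s - A * m * s))
      + m * e * (- (b * A * m * e))
      = b * (m * (k * c\<^sup>2 + s\<^sup>2) - A * (m\<^sup>2 * ((k * c)\<^sup>2 + s\<^sup>2 + e\<^sup>2)))"
      by (simp add: algebra_simps power2_eq_square)
    then show ?thesis unfolding norm A by simp
  qed
  have uw': "b * (c - A * m * k * c) * c + b * (s - A * m * s) * s + - (b * A * m * e) * 0 = B"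
  proof -
    have "b * (c - A * m * k * c) * c + b * (s - A * m * s) * s + - (b * A * m * e) * 0
      = b * ((c\<^sup>2 + s\<^sup>2) - A * (m * (k * c\<^sup>2 + s\<^sup>2)))"
      by (simp add: algebra_simps power2_eq_square)
    also have "\<dots> = b * (B * B)" using AB unfolding A s(2) by (simp add: power2_eq_square)
    also have "\<dots> = B" using b by simp
    finally show ?thesis .
  qed
  have w'w': "b * (c - A * m * k * c) * (b * (c - A * m * k * c)) + b * (s - A * m * s) * (b * (s - A * m * s))
      + - (b * A * m * e) * - (b * A * m * e) = 1"
  proof -
    have "b * (c - A * m * k * c) * (b * (c - A * m * k * c)) + b * (s - A * m * s) * (b * (s - A * m * s))
      + - (b * A * m * e) * - (b * A * m * e)
      = b\<^sup>2 * ((c\<^sup>2 + s\<^sup>2) - 2 * A * (m * (k * c\<^sup>2 + s\<^sup>2)) + A\<^sup>2 * (m\<^sup>2 * ((k * c)\<^sup>2 + s\<^sup>2 + e\<^sup>2)))"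
      by (simp add: algebra_simps power2_eq_square)
    also have "\<dots> = b\<^sup>2 * B\<^sup>2"
    proof -
      have "1 - 2 * A * A + A\<^sup>2 * 1 = B\<^sup>2" using AB by (simp add: power2_eq_square)
      then show ?thesis unfolding norm A s(2) by simp
    qed
    also have "\<dots> = (b * B)\<^sup>2" by (simp add: power_mult_distrib)
    also have "\<dots> = 1" using b by simp
    finally show ?thesis .
  qed
  have rw': "0 * (b * (c - A * m * k * c)) + e * (b * (s - A * m * s)) + - s * - (b * A * m * e) = b * e * s"
    by (simp add: algebra_simps)
  have "c - A * m * k * c = c * (1 - A * m * k)" by (simp add: algebra_simps)
  then have w'v: "b * (c - A * m * k * c) \<noteq> 0" using b c small by simp
  have \<rho>r: "- (c * e) * e + c * s * (1 - k) * - s < 0"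
  proof -
    have "c * e * e + c * s * s * (1 - k) > 0" using c s par by (intro add_pos_pos mult_pos_pos) simp_all
    then show ?thesis by (simp add: algebra_simps)
  qed
  obtain X where X: "finite X" "vector_set d (S \<union> X)"
    "\<And>x z. x \<in> X \<Longrightarrow> z \<in> F \<Longrightarrow> braket z x \<noteq> 0"
    "\<And>A. col d (S \<union> X) A \<Longrightarrow> \<not> (u \<in> A \<and> v \<in> A)"
    "\<And>A. col d S A \<Longrightarrow> \<not> (u \<in> A \<and> v \<in> A) \<Longrightarrow> \<exists>A'. col d (S \<union> X) A' \<and> A' \<inter> S = A"
  proof (rule chain_gadget[of d S u v F w w' \<rho> r])
    show "braket w w = 1"
      using norm unfolding defs LL
      by (simp add: power2_eq_square algebra_simps del: of_real_add of_real_mult)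
    show "braket w' w' = 1" unfolding defs LL w'w' by simp
    show "braket w w' = 0" unfolding defs LL ww' by simp
    show "braket \<rho> u = 0" "braket \<rho> w = 0" "braket \<rho> w' = 0" "braket r w = 0"
      unfolding defs uL LL of_real_eq_0_iff by (simp_all add: algebra_simps)
    show "braket r v = 0" unfolding defs Lv by simp
    show "braket w u \<noteq> 0" "braket w' u \<noteq> 0" unfolding defs uL LL uw uw' using par by simp_all
    show "braket w v \<noteq> 0" "braket w' v \<noteq> 0" "braket \<rho> v \<noteq> 0"
      unfolding defs Lv using zt(1) par c s w'v
      by (simp_all del: of_real_mult of_real_diff)
    show "braket \<rho> r \<noteq> 0" unfolding defs LL of_real_eq_0_iff using \<rho>r by simp
    show "braket r u \<noteq> 0" unfolding defs uL LL of_real_eq_0_iff using par s by simp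
    show "braket r w' \<noteq> 0" unfolding defs LL of_real_eq_0_iff rw' using par s b by simp
    show "(cmod (braket w' u))\<^sup>2 < 1 / 9" unfolding defs uL LL uw' using small by simp
    show "(cmod (braket v w))\<^sup>2 < 1 / 9"
      unfolding defs vL using small cz by (simp add: norm_mult power_mult_distrib)
    show "u \<in> span2 w w'" by (rule u_span)
    show "w \<in> carrier_vec d" "w' \<in> carrier_vec d" "\<rho> \<in> carrier_vec d" "r \<in> carrier_vec d"
      unfolding defs by (rule Lc)+
  qed (use d S uv F nzF in auto)
  show ?thesis by (rule that[OF X])
qed

section \<open>The gadget of order \<open>(d, d - 1)\<close>\<close>

text \<open>Vectors added for one pair must not enter the plane of a later one. Hence
  \<open>y j\<close> belongs to \<open>F\<close> for every pending pair \<open>j\<close>, and each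
  new vector has nonzero overlap with it. The last assumption on \<open>y\<close> makes these
  certificates admissible members of \<open>F\<close>.\<close>

lemma exclude_family:
  fixes m e y :: "nat \<Rightarrow> complex vec"
  assumes d: "d \<ge> 3" and S0: "vector_set d S0"
    and mem: "\<And>i. i < d \<Longrightarrow> m i \<in> S0" "\<And>i. i < d \<Longrightarrow> e i \<in> S0"
    and ov: "\<And>i. i < d \<Longrightarrow> braket (e i) (m i) \<noteq> 0" "\<And>i. i < d \<Longrightarrow> (cmod (braket (e i) (m i)))\<^sup>2 \<le> 9 / 25"
    and y: "\<And>i. i < d \<Longrightarrow> y i \<in> carrier_vec d"
      "\<And>i. i < d \<Longrightarrow> braket (y i) (m i) = 0" "\<And>i. i < d \<Longrightarrow> braket (y i) (e i) = 0"
      "\<And>i z. i < d \<Longrightarrow> z \<in> S0 - {m i, e i} \<Longrightarrow> braket (y i) z \<noteq> 0"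
      "\<And>i j. i < d \<Longrightarrow> j < d \<Longrightarrow> i \<noteq> j \<Longrightarrow> y j \<notin> span2 (m i) (e i)"
  obtains S where "S0 \<subseteq> S" "vector_set d S"
    "\<And>A i. col d S A \<Longrightarrow> i < d \<Longrightarrow> \<not> (m i \<in> A \<and> e i \<in> A)"
    "\<And>A. col d S0 A \<Longrightarrow> (\<And>i. i < d \<Longrightarrow> \<not> (m i \<in> A \<and> e i \<in> A)) \<Longrightarrow> \<exists>A'. col d S A' \<and> A' \<inter> S0 = A"
proof -
  have "\<exists>S. S0 \<subseteq> S \<and> vector_set d S \<and>
      (\<forall>j z. k \<le> j \<longrightarrow> j < d \<longrightarrow> z \<in> S - {m j, e j} \<longrightarrow> braket (y j) z \<noteq> 0) \<and>
      (\<forall>A i. col d S A \<longrightarrow> i < k \<longrightarrow> \<not> (m i \<in> A \<and> e i \<in> A)) \<and>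
      (\<forall>A. col d S0 A \<longrightarrow> (\<forall>i<d. \<not> (m i \<in> A \<and> e i \<in> A)) \<longrightarrow> (\<exists>A'. col d S A' \<and> A' \<inter> S0 = A))"
    if "k \<le> d" for k
    using that
  proof (induction k)
    case 0
    have "A \<inter> S0 = A" if "col d S0 A" for A using that by (auto simp: col_def)
    then show ?case using S0 y(4) by (intro exI[of _ S0]) auto
  next
    case (Suc k)
    then have k: "k < d" by simp
    obtain S where S: "S0 \<subseteq> S" "vector_set d S"
      and S_y: "\<And>j z. k \<le> j \<Longrightarrow> j < d \<Longrightarrow> z \<in> S - {m j, e j} \<Longrightarrow> braket (y j) z \<noteq> 0"
      and S_ex: "\<And>A i. col d S A \<Longrightarrow> i < k \<Longrightarrow> \<not> (m i \<in> A \<and> e i \<in> A)"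
      and S_ext: "\<And>A. col d S0 A \<Longrightarrow> \<forall>i<d. \<not> (m i \<in> A \<and> e i \<in> A) \<Longrightarrow> \<exists>A'. col d S A' \<and> A' \<inter> S0 = A"
      using Suc.IH k by (auto simp: less_imp_le)
    have Sc: "finite S" "S \<subseteq> carrier_vec d" using S(2) by (auto simp: vector_set_def)
    have mk: "m k \<in> S" "e k \<in> S" using mem[OF k] S(1) by auto
    then have mkc: "m k \<in> carrier_vec d" "e k \<in> carrier_vec d" using Sc by auto
    define F where "F = (S - {m k, e k}) \<union> y ` {Suc k..<d}"
    have F: "finite F" "F \<subseteq> carrier_vec d" "S - {m k, e k} \<subseteq> F" using Sc y(1) by (auto simp: F_def)
    have "(S - {m k, e k}) \<inter> span2 (m k) (e k) = {}"
      by (rule not_in_span2[OF mkc y(1-3)[OF k]]) (use S_y[of k] k in auto)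
    moreover have "y ` {Suc k..<d} \<inter> span2 (m k) (e k) = {}" using y(5)[OF k] by auto
    ultimately have Fs: "F \<inter> span2 (m k) (e k) = {}" unfolding F_def by blast
    obtain X where X: "finite X" "vector_set d (S \<union> X)"
      "\<And>x z. x \<in> X \<Longrightarrow> z \<in> F \<Longrightarrow> braket z x \<noteq> 0"
      "\<And>A. col d (S \<union> X) A \<Longrightarrow> \<not> (m k \<in> A \<and> e k \<in> A)"
      "\<And>A. col d S A \<Longrightarrow> \<not> (m k \<in> A \<and> e k \<in> A) \<Longrightarrow> \<exists>A'. col d (S \<union> X) A' \<and> A' \<inter> S = A"
      by (rule exclude_pair[OF d S(2) mk ov[OF k] F Fs], rule that; blast)
    have "braket (y j) z \<noteq> 0" if "Suc k \<le> j" "j < d" "z \<in> S \<union> X - {m j, e j}" for j z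
    proof (cases "z \<in> S")
      case True
      then show ?thesis using S_y[of j z] that by simp
    next
      case False
      then show ?thesis using X(3)[of z "y j"] that by (simp add: F_def)
    qed
    moreover have "\<not> (m i \<in> A \<and> e i \<in> A)" if A: "col d (S \<union> X) A" "i < Suc k" for A i
    proof (cases "i = k")
      case True
      then show ?thesis using X(4)[OF A(1)] by simp
    next
      case False
      then have "i < k" using A by simp
      then have "\<not> (m i \<in> A \<inter> S \<and> e i \<in> A \<inter> S)"
        using S_ex[OF col_restrict[OF A(1), of S]] by blast
      then show ?thesis using mem[of i] S(1) \<open>i < k\<close> k by auto
    qed
    moreover have "\<exists>A'. col d (S \<union> X) A' \<and> A' \<inter> S0 = A"
      if A: "col d S0 A" "\<forall>i<d. \<not> (m i \<in> A \<and> e i \<in> A)" for A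
    proof -
      obtain B where B: "col d S B" "B \<inter> S0 = A" using S_ext[OF A] by blast
      have "\<not> (m k \<in> B \<and> e k \<in> B)" using A(2) B(2) k mem[OF k] by auto
      then obtain A' where "col d (S \<union> X) A'" "A' \<inter> S = B" using X(5)[OF B(1)] by blast
      then show ?thesis using B(2) S(1) by blast
    qed
    ultimately show ?case using S(1) X(2) by (intro exI[of _ "S \<union> X"]) blast
  qed
  from this[OF order_refl] obtain S where S: "S0 \<subseteq> S" "vector_set d S"
    "\<forall>A i. col d S A \<longrightarrow> i < d \<longrightarrow> \<not> (m i \<in> A \<and> e i \<in> A)"
    "\<forall>A. col d S0 A \<longrightarrow> (\<forall>i<d. \<not> (m i \<in> A \<and> e i \<in> A)) \<longrightarrow> (\<exists>A'. col d S A' \<and> A' \<inter> S0 = A)"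
    by (elim exE conjE) (rule that)
  show ?thesis by (rule that[OF S(1,2)]) (use S(3,4) in simp_all)
qed

section \<open>Colorings as functions and as sets\<close>

lemma clique_number_eq:
  assumes S: "vector_set d S" and E: "is_clique S orthogonal_vecs E" "card E = d"
  shows "clique_number S orthogonal_vecs = d"
proof -
  have fin: "finite S" using S by (simp add: vector_set_def)
  have le: "card C \<le> d" if "is_clique S orthogonal_vecs C" for C
  proof (rule card_orthonormal_le)
    show "finite C" using that fin finite_subset by (auto simp: is_clique_def)
  qed (use that S in \<open>auto simp: is_clique_def vector_set_def orthogonal_vecs_def\<close>)
  have "{C. is_clique S orthogonal_vecs C} \<subseteq> Pow S" by (auto simp: is_clique_def)
  then have "finite {C. is_clique S orthogonal_vecs C}" using fin finite_subset by blast
  then show ?thesis unfolding clique_number_def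
    by (intro Max_eqI) (use le E in auto)
qed

lemma vector_coloring_indicator:
  assumes S: "finite S" "clique_number S orthogonal_vecs = d" and A: "col d S A"
  shows "vector_coloring S (\<lambda>v. if v \<in> A then 1 else 0)"
proof -
  have one: "x = y" if "is_clique S orthogonal_vecs C" "x \<in> C \<inter> A" "y \<in> C \<inter> A" for C x y
    using that A unfolding is_clique_def col_def by blast
  have "(\<Sum>v\<in>C. if v \<in> A then 1 else 0) \<le> (1 :: nat)" if C: "is_clique S orthogonal_vecs C" for C
  proof -
    have fC: "finite C" using C S finite_subset by (auto simp: is_clique_def)
    have "(\<Sum>v\<in>C. if v \<in> A then 1 else 0) = card (C \<inter> A)"
      using fC by (simp add: sum.If_cases Int_def)
    also have "\<dots> \<le> 1" using one[OF C] fC by (auto simp: card_le_Suc0_iff_eq)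
    finally show ?thesis .
  qed
  moreover have "\<exists>!v. v \<in> C \<and> (if v \<in> A then 1 else 0) = (1 :: nat)"
    if C: "is_clique S orthogonal_vecs C" "card C = d" for C
  proof -
    obtain v where "v \<in> C \<inter> A" using A C unfolding col_def by blast
    then show ?thesis using one[OF C(1)] by (intro ex1I[of _ v]) (auto split: if_splits)
  qed
  ultimately show ?thesis using S(2) by (auto simp: zero_one_coloring_def)
qed

text \<open>Independence is the clique condition for two-element cliques; symmetry of orthogonality
  enters because \<open>is_clique\<close> asks for adjacency in both directions.\<close>

lemma col_of_vector_coloring:
  assumes S: "vector_set d S" "clique_number S orthogonal_vecs = d" and f: "vector_coloring S f"
  shows "col d S {v \<in> S. f v = 1}"
proof -
  have "\<not> orthogonal_vecs x y" if xy: "x \<in> S" "y \<in> S" "f x = 1" "f y = 1" "x \<noteq> y" for x y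
  proof
    assume o: "orthogonal_vecs x y"
    moreover have "x \<in> carrier_vec d" "y \<in> carrier_vec d" using S(1) xy by (auto simp: vector_set_def)
    ultimately have "orthogonal_vecs y x" using orthogonal_commute by blast
    then have "is_clique S orthogonal_vecs {x, y}" using o xy by (auto simp: is_clique_def)
    then have "(\<Sum>v\<in>{x, y}. f v) \<le> 1" using f unfolding zero_one_coloring_def by blast
    then show False using xy by simp
  qed
  moreover have "C \<inter> {v \<in> S. f v = 1} \<noteq> {}" if "is_clique S orthogonal_vecs C" "card C = d" for C
  proof -
    have "\<exists>!v. v \<in> C \<and> f v = 1" using f S(2) that unfolding zero_one_coloring_def by blast
    moreover have "C \<subseteq> S" using that by (simp add: is_clique_def)
    ultimately show ?thesis by blast
  qed
  ultimately show ?thesis by (auto simp: col_def)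
qed

lemma braket_unit_vec:
  assumes "v \<in> carrier_vec d" "i < d"
  shows "braket (unit_vec d i) v = v $ i"
proof -
  have "braket (unit_vec d i) v = (\<Sum>j<d. if j = i then v $ j else 0)"
    unfolding braket_sum[OF unit_vec_carrier assms(1)]
    by (intro sum.cong) (auto simp: unit_vec_def)
  then show ?thesis using assms by simp
qed

theorem mainTheorem5:
  fixes d :: nat and \<epsilon> :: real
  assumes "d \<ge> 3" and "\<epsilon> > 0"
  shows "\<exists>(S :: complex vec set) (m :: nat \<Rightarrow> complex vec).
           gadget d (d - 1) d S (m ` {1..d}) \<and>
           (\<forall>i\<in>{1..d}. \<forall>j\<in>{1..d}. i \<noteq> j \<longrightarrow>
              braket (m i) (m j) \<in> \<real> \<and> Re (braket (m i) (m j)) > 1 - \<epsilon>)"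
proof -
  note d = assms(1)
  \<comment> \<open>Positive, to keep the \<open>M i\<close> apart; at most 1/2, so that no
    coordinate of \<open>M i\<close> vanishes and the square of \<open>\<eta>\<close> stays below
    \<open>\<epsilon>\<close>.\<close>
  define \<eta> where "\<eta> = min (1 / 2) \<epsilon>"
  have \<eta>: "0 < \<eta>" "\<eta> \<le> 1 / 2" "\<eta> \<le> \<epsilon>" using assms(2) by (auto simp: \<eta>_def)
  \<comment> \<open>The squared norm of \<open>(1, ..., 1 - \<eta>, ..., 1)\<close>. Distinct
    vectors of this kind have inner product \<open>d - 2 * \<eta>\<close>, so after scaling the
    overlap is 1 minus the square of \<open>\<eta>\<close> divided by \<open>N\<close>.\<close>
  define N where "N = (1 - \<eta>)\<^sup>2 + real d - 1"
  have "real d \<ge> 3" using d by simp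
  then have N: "N \<ge> 2" unfolding N_def using zero_le_power2[of "1 - \<eta>"] by linarith
  have Nd: "real d - 2 * \<eta> = N - \<eta>\<^sup>2" by (simp add: N_def power2_eq_square algebra_simps)
  define \<mu> where "\<mu> = 1 / sqrt N"
  have \<mu>: "\<mu> > 0" "\<mu>\<^sup>2 = 1 / N" using N by (auto simp: \<mu>_def power_divide)
  define M where "M i = vec d (\<lambda>k. complex_of_real (\<mu> * (if k = i then 1 - \<eta> else 1)))" for i
  define e where "e i = (unit_vec d i :: complex vec)" for i
  have Mc: "M i \<in> carrier_vec d" and ec: "e i \<in> carrier_vec d" for i by (auto simp: M_def e_def)
  have eM: "braket (e i) (M j) = complex_of_real (\<mu> * (if i = j then 1 - \<eta> else 1))" if "i < d" for i j
    unfolding e_def braket_unit_vec[OF Mc that] using that by (simp add: M_def)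
  have ee: "braket (e i) (e j) = (if i = j then 1 else 0)" if "i < d" "j < d" for i j
    using braket_unit_vec[OF ec that(1)] that by (simp add: e_def unit_vec_def)
  have MM: "braket (M i) (M j) = complex_of_real (if i = j then 1 else 1 - \<eta>\<^sup>2 / N)" if ij: "i < d" "j < d" for i j
  proof -
    have "braket (M i) (M j) = complex_of_real (\<Sum>k<d. \<mu>\<^sup>2 * ((if k = i then 1 - \<eta> else 1) * (if k = j then 1 - \<eta> else 1)))"
      unfolding braket_sum[OF Mc Mc] of_real_sum
      using ij by (intro sum.cong) (auto simp: M_def power2_eq_square)
    also have "(\<Sum>k<d. \<mu>\<^sup>2 * ((if k = i then 1 - \<eta> else 1) * (if k = j then 1 - \<eta> else 1)))
      = \<mu>\<^sup>2 * (\<Sum>k<d. (1 + (if k = i then - \<eta> else 0)) * (1 + (if k = j then - \<eta> else 0)))"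
      unfolding sum_distrib_left by (intro sum.cong) auto
    also have "(\<Sum>k<d. (1 + (if k = i then - \<eta> else 0)) * (1 + (if k = j then - \<eta> else 0)))
      = (\<Sum>k<d. 1 + ((if k = i then - \<eta> else 0) + (if k = j then - \<eta> else 0)
          + (if k = i then if i = j then \<eta>\<^sup>2 else 0 else 0)))"
      by (intro sum.cong) (auto simp: algebra_simps power2_eq_square)
    also have "\<dots> = real d - 2 * \<eta> + (if i = j then \<eta>\<^sup>2 else 0)"
      using ij by (simp add: sum.distrib)
    also have "\<mu>\<^sup>2 * (real d - 2 * \<eta> + (if i = j then \<eta>\<^sup>2 else 0)) = (if i = j then 1 else 1 - \<eta>\<^sup>2 / N)"
      using N unfolding \<mu>(2) Nd by (auto simp: diff_divide_distrib)
    finally show ?thesis .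
  qed
  have "\<eta>\<^sup>2 < \<epsilon>"
  proof -
    have "\<eta> * \<eta> \<le> 1 / 2 * \<epsilon>" using \<eta> by (intro mult_mono) auto
    then show ?thesis using assms(2) by (simp add: power2_eq_square)
  qed
  moreover have "\<eta>\<^sup>2 / N \<le> \<eta>\<^sup>2" using N by (simp add: divide_le_eq mult_le_cancel_left1)
  ultimately have overlap: "\<eta>\<^sup>2 / N < \<epsilon>" by simp
  have "\<eta>\<^sup>2 < 1" using \<eta> by (simp add: power_less_one_iff abs_square_less_1)
  then have MMpos: "1 - \<eta>\<^sup>2 / N > 0" using \<open>\<eta>\<^sup>2 / N \<le> \<eta>\<^sup>2\<close> by simp
  \<comment> \<open>\<open>y i\<close> is orthogonal to \<open>M i\<close> and \<open>e i\<close> but to no other initial vector, which keeps those outside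
    the plane of the pair. Its coordinates sum to 0, with 0 at \<open>i\<close> and \<open>- (d - 2)\<close> at \<open>k0 i \<noteq> i\<close>.\<close>
  define k0 where "k0 i = (if i = 0 then 1 else 0 :: nat)" for i :: nat
  define c where "c i k = (if k = i then 0 else if k = k0 i then - (real d - 2) else 1)" for i k :: nat
  define y where "y i = vec d (\<lambda>k. complex_of_real (c i k))" for i
  have yc: "y i \<in> carrier_vec d" for i by (simp add: y_def)
  have c0: "c i k = 0 \<longleftrightarrow> k = i" for i k using d by (auto simp: c_def k0_def)
  have csum: "(\<Sum>k<d. c i k) = 0" if "i < d" for i
  proof -
    have "(\<Sum>k<d. c i k) = (\<Sum>k<d. 1 + ((if k = i then - 1 else 0) + (if k = k0 i then - (real d - 1) else 0)))"
      by (intro sum.cong) (auto simp: c_def k0_def)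
    then show ?thesis using that d by (simp add: sum.distrib k0_def)
  qed
  have yM: "braket (y i) (M j) = complex_of_real (- (\<mu> * \<eta> * c i j))" if ij: "i < d" "j < d" for i j
  proof -
    have "braket (y i) (M j) = complex_of_real (\<Sum>k<d. \<mu> * (c i k + (if k = j then - \<eta> * c i k else 0)))"
      unfolding braket_sum[OF yc Mc] of_real_sum
      using ij by (intro sum.cong) (auto simp: M_def y_def algebra_simps)
    also have "(\<Sum>k<d. \<mu> * (c i k + (if k = j then - \<eta> * c i k else 0))) = - (\<mu> * \<eta> * c i j)"
      using ij csum by (simp add: sum_distrib_left[symmetric] sum.distrib)
    finally show ?thesis .
  qed
  have ye: "braket (y i) (e j) = complex_of_real (c i j)" if "j < d" for i j
  proof -
    have "braket (e j) (y i) = complex_of_real (c i j)"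
      unfolding e_def braket_unit_vec[OF yc that] using that by (simp add: y_def)
    then show ?thesis using braket_cnj[OF ec yc] by simp
  qed
  define E where "E = e ` {..<d}"
  define T where "T = M ` {..<d}"
  define S0 where "S0 = E \<union> T"
  have fin: "finite E" "finite T" by (auto simp: E_def T_def)
  have eM0: "braket (e i) (M j) \<noteq> 0" "braket (M j) (e i) \<noteq> 0" if "i < d" for i j
    using eM[OF that, of j] \<mu> \<eta> braket_cnj[OF ec[of i] Mc[of j]] by auto
  have MM0: "braket (M i) (M j) \<noteq> 0" if "i < d" "j < d" for i j
    using MM[OF that] MMpos by (auto simp del: of_real_diff)
  have yM0: "braket (y i) (M j) = 0 \<longleftrightarrow> j = i" "braket (y i) (e j) = 0 \<longleftrightarrow> j = i" if "i < d" "j < d" for i j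
    using yM[OF that] ye[OF that(2), of i] c0 \<mu> \<eta> by auto
  have e_inj: "e i = e j \<longleftrightarrow> i = j" and M_inj: "M i = M j \<longleftrightarrow> i = j" if "i < d" "j < d" for i j
    using ee[OF that] ee[OF that(1) that(1)] yM0[OF that(1) that(1)] yM0[OF that]
    by (auto split: if_splits)
  have eM_ne: "e i \<noteq> M j" if "i < d" "j < d" for i j
  proof
    assume eq: "e i = M j"
    obtain l where l: "l < d" "l \<noteq> i" using d by (metis Suc_le_lessD less_trans nat_neq_iff numeral_3_eq_3 zero_less_Suc lessI)
    then show False using eM0(1)[OF l(1), of j] ee[OF l(1) that(1)] eq by simp
  qed
  have vS0: "vector_set d S0"
  proof (rule vector_setI)
    show "finite S0" "S0 \<subseteq> carrier_vec d" using fin Mc ec by (auto simp: S0_def E_def T_def)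
    show "braket x x = 1" if "x \<in> S0" for x
      using that ee MM by (auto simp: S0_def E_def T_def)
    have sepe: "\<exists>r\<in>carrier_vec d. (braket r (e i) = 0) \<noteq> (braket r (M j) = 0)" if "i < d" "j < d" for i j
    proof -
      obtain l where l: "l < d" "l \<noteq> i" using d by (metis Suc_le_lessD less_trans nat_neq_iff numeral_3_eq_3 zero_less_Suc lessI)
      then show ?thesis using eM0(1)[OF l(1), of j] ee[OF l(1) that(1)] ec by (intro bexI[of _ "e l"]) auto
    qed
    show "\<exists>r\<in>carrier_vec d. (braket r x = 0) \<noteq> (braket r z = 0)" if xz: "x \<in> S0" "z \<in> S0" "x \<noteq> z" for x z
    proof -
      consider i j where "i < d" "j < d" "x = e i" "z = e j" | i j where "i < d" "j < d" "x = e i" "z = M j"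
        | i j where "i < d" "j < d" "x = M i" "z = e j" | i j where "i < d" "j < d" "x = M i" "z = M j"
        using xz unfolding S0_def E_def T_def by blast
      then show ?thesis
      proof cases
        case 1 then show ?thesis using xz(3) ee ec by (intro bexI[of _ "e i"]) auto
      next
        case 2 then show ?thesis using sepe by simp
      next
        case 3 then show ?thesis using sepe by metis
      next
        case 4 then show ?thesis using xz(3) yM0 yc by (intro bexI[of _ "y i"]) auto
      qed
    qed
  qed
  \<comment> \<open>Vectors in the plane are constant away from coordinate \<open>i\<close>.
    \<open>y j\<close> is not: it is 0 at \<open>j\<close> and nonzero at a third index, which
    exists because \<open>d >= 3\<close>.\<close>
  have yspan: "y j \<notin> span2 (M i) (e i)" if ij: "i < d" "j < d" "i \<noteq> j" for i j
  proof
    assume "y j \<in> span2 (M i) (e i)"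
    then obtain a b where ab: "y j = a \<cdot>\<^sub>v M i + b \<cdot>\<^sub>v e i" by (auto simp: span2_def)
    have y_off: "y j $ k = a * complex_of_real \<mu>" if "k < d" "k \<noteq> i" for k
      unfolding ab using that by (simp add: M_def e_def unit_vec_def)
    have "a * complex_of_real \<mu> = 0" using y_off[of j] ij c0[of j j] by (simp add: y_def)
    obtain l where l: "l < d" "l \<noteq> i" "l \<noteq> j"
    proof -
      have "card {i, j} < card {..<d}" using d by (simp add: card_insert_if)
      then have "\<not> {..<d} \<subseteq> {i, j}" using card_mono[of "{i, j}" "{..<d}"] by auto
      then show ?thesis using that by auto
    qed
    then have "c j l = 0" using y_off[of l] \<open>a * complex_of_real \<mu> = 0\<close> by (simp add: y_def)
    then show False using c0 l by simp
  qed
  \<comment> \<open>As \<open>d - 1 >= 2\<close>, \<open>N\<close> is at least three times the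
    square of \<open>1 - \<eta>\<close>; and 1/3 is below 9/25.\<close>
  have ov: "(cmod (braket (e i) (M i)))\<^sup>2 \<le> 9 / 25" if "i < d" for i
  proof -
    have "(cmod (braket (e i) (M i)))\<^sup>2 = (1 - \<eta>)\<^sup>2 / N"
      using eM[OF that, of i] \<mu>(2) by (simp add: norm_mult power_mult_distrib del: of_real_mult)
    also have "\<dots> \<le> 1 / 3"
    proof -
      have "(1 - \<eta>)\<^sup>2 \<le> 1\<^sup>2" using \<eta> by (intro power_mono) auto
      then have "3 * (1 - \<eta>)\<^sup>2 \<le> N" using d by (simp add: N_def)
      then show ?thesis using N by (simp add: field_simps)
    qed
    finally show ?thesis by simp
  qed
  obtain S where S: "S0 \<subseteq> S" "vector_set d S"
    and excl: "\<And>A i. col d S A \<Longrightarrow> i < d \<Longrightarrow> \<not> (M i \<in> A \<and> e i \<in> A)"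
    and ext: "\<And>A. col d S0 A \<Longrightarrow> (\<And>i. i < d \<Longrightarrow> \<not> (M i \<in> A \<and> e i \<in> A)) \<Longrightarrow> \<exists>A'. col d S A' \<and> A' \<inter> S0 = A"
  proof (rule exclude_family[of d S0 M e y])
    show "braket (y i) z \<noteq> 0" if "i < d" "z \<in> S0 - {M i, e i}" for i z
      using that yM0 by (auto simp: S0_def E_def T_def)
  qed (use d vS0 ov yc yM0 yspan eM0 in \<open>auto simp: S0_def E_def T_def\<close>)
  have ES: "is_clique S orthogonal_vecs E" "card E = d"
  proof -
    show "is_clique S orthogonal_vecs E"
      using S(1) ee by (auto simp: is_clique_def S0_def E_def orthogonal_vecs_def)
    show "card E = d" using e_inj by (simp add: E_def card_image inj_on_def)
  qed
  have cl: "clique_number S orthogonal_vecs = d" by (rule clique_number_eq[OF S(2) ES])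
  have cT: "card T = d" using M_inj by (simp add: T_def card_image inj_on_def)
  have TS: "T \<subset> S"
  proof -
    have "e 0 \<notin> T" "e 0 \<in> S" using eM_ne d S(1) by (auto simp: S0_def E_def T_def)
    then show ?thesis using S(1) by (auto simp: S0_def)
  qed
  have good: "\<exists>f. vector_coloring S f \<and> (\<forall>v\<in>R. f v = 1)" if R: "R \<subseteq> T" "card R \<le> d - 1" for R
  proof -
    have "R \<noteq> T" using R(2) cT d by auto
    then obtain j where j: "j < d" "M j \<notin> R" using R(1) by (auto simp: T_def)
    \<comment> \<open>The one \<open>M j\<close> left out of \<open>R\<close> makes it harmless to
      place the value 1 of the standard basis at \<open>e j\<close>; all other \<open>M i\<close>
      can then have value 1.\<close>
    define A where "A = insert (e j) (M ` ({..<d} - {j}))"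
    have "\<not> orthogonal_vecs x z" if "x \<in> A" "z \<in> A" "x \<noteq> z" for x z
      using that eM0 MM0 j by (auto simp: A_def orthogonal_vecs_def)
    moreover have "C \<inter> A \<noteq> {}" if C: "is_clique S0 orthogonal_vecs C" "card C = d" for C
    proof -
      \<comment> \<open>No vector of \<open>S0\<close> is orthogonal to \<open>M i\<close>, so the
        standard basis is the only clique of size \<open>d\<close> in \<open>S0\<close>.\<close>
      have nM: "C = {M i}" if i: "M i \<in> C" "i < d" for i
      proof -
        have "z = M i" if "z \<in> C" for z
        proof (rule ccontr)
          assume "z \<noteq> M i"
          then have "orthogonal_vecs z (M i)" "z \<in> S0" using C(1) i that by (auto simp: is_clique_def)
          then show False using eM0 MM0 i by (auto simp: S0_def E_def T_def orthogonal_vecs_def)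
        qed
        then show ?thesis using i by blast
      qed
      have "C \<subseteq> E"
      proof
        fix x assume x: "x \<in> C"
        have "x \<notin> T"
        proof
          assume "x \<in> T"
          then obtain i where "i < d" "x = M i" by (auto simp: T_def)
          then have "C = {x}" using nM[of i] x by simp
          then have "card C = 1" by simp
          then show False using C(2) d by simp
        qed
        then show "x \<in> E" using x C(1) by (auto simp: is_clique_def S0_def)
      qed
      then have "C = E" using C(2) ES(2) fin card_subset_eq by metis
      then show ?thesis using j by (auto simp: A_def E_def)
    qed
    moreover have "A \<subseteq> S0" using j by (auto simp: A_def S0_def E_def T_def)
    ultimately have "col d S0 A" by (auto simp: col_def)
    moreover have "\<not> (M i \<in> A \<and> e i \<in> A)" if "i < d" for i
    proof (cases "i = j")
      case True
      have "M j \<noteq> e j" using eM_ne[OF j(1) j(1)] by simp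
      moreover have "M j \<notin> M ` ({..<d} - {j})" using M_inj[OF j(1)] by auto
      ultimately show ?thesis using True by (simp add: A_def)
    next
      case False
      then have "e i \<noteq> e j" using e_inj[OF that j(1)] by simp
      moreover have "e i \<notin> M ` ({..<d} - {j})" using eM_ne[OF that] by auto
      ultimately show ?thesis by (simp add: A_def)
    qed
    ultimately obtain A' where A': "col d S A'" "A' \<inter> S0 = A" using ext by blast
    have "R \<subseteq> A"
    proof
      fix x assume "x \<in> R"
      then obtain i where "i < d" "x = M i" "i \<noteq> j" using R(1) j by (auto simp: T_def)
      then show "x \<in> A" by (auto simp: A_def)
    qed
    then have "\<forall>v\<in>R. v \<in> A'" using A'(2) by blast
    moreover have "finite S" using S(2) by (simp add: vector_set_def)
    ultimately show ?thesis
      using vector_coloring_indicator[OF _ cl A'(1)] by (intro exI[of _ "\<lambda>v. if v \<in> A' then 1 else 0"]) auto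
  qed
  have bad: "\<not> (\<exists>f. vector_coloring S f \<and> (\<forall>v\<in>R. f v = 1))" if R: "R \<subseteq> T" "card R > d - 1" for R
  proof
    assume "\<exists>f. vector_coloring S f \<and> (\<forall>v\<in>R. f v = 1)"
    then obtain f where f: "vector_coloring S f" "\<forall>v\<in>R. f v = 1" by blast
    \<comment> \<open>More than \<open>d - 1\<close> vectors means all of \<open>T\<close>.
      Whichever basis vector \<open>e i\<close> has value 1, its excluded partner \<open>M i\<close>
      has value 1 too.\<close>
    have "card R = card T" using R cT card_mono[OF fin(2) R(1)] by simp
    then have RT: "R = T" using R(1) fin card_subset_eq by blast
    have A: "col d S {v \<in> S. f v = 1}" by (rule col_of_vector_coloring[OF S(2) cl f(1)])
    then have "E \<inter> {v \<in> S. f v = 1} \<noteq> {}" using ES unfolding col_def by blast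
    then obtain i where "i < d" "f (e i) = 1" "e i \<in> S" by (auto simp: E_def)
    moreover from this have "M i \<in> T" by (simp add: T_def)
    ultimately show False using excl[OF A, of i] f(2) RT TS by auto
  qed
  have "gadget d (d - 1) d S T"
    unfolding gadget_def
  proof (intro conjI)
    show "\<exists>f. vector_coloring S f" using good[of "{}"] by auto
    show "\<forall>u\<in>T. \<forall>v\<in>T. u \<noteq> v \<longrightarrow> \<not> orthogonal_vecs u v"
      using MM0 by (auto simp: T_def orthogonal_vecs_def)
  qed (use S cl TS cT good bad in auto)
  moreover have "T = (\<lambda>i. M (i - 1)) ` {1..d}"
  proof -
    have "{..<d} = (\<lambda>i. i - 1) ` {1..d}" by force
    then show ?thesis by (simp add: T_def image_image)
  qed
  moreover have "braket (M (i - 1)) (M (j - 1)) \<in> \<real> \<and> Re (braket (M (i - 1)) (M (j - 1))) > 1 - \<epsilon>"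
    if "i \<in> {1..d}" "j \<in> {1..d}" "i \<noteq> j" for i j
    using MM[of "i - 1" "j - 1"] that overlap by auto
  ultimately show ?thesis by (intro exI[of _ S] exI[of _ "\<lambda>i. M (i - 1)"]) auto
qed

end
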